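(* $\mathbb{T}$ is a semisimple $\mathbb{F}$-algebra if and only if the factorial scheme $(X,\{R_{\mathbf g}:\mathbf g\in E\})$ is $p'$-valenced, i.e. $p\nmid k_{\mathbf g}$ for every $\mathbf g\in E$.
   Context: Let $\mathbb{F}$ be a field of characteristic $p\ge 0$; for a positive integer $m$, "$p\mid m$" means that the image of $m$ in $\mathbb{F}$ is zero (so for $p=0$ it never holds). Let $n\ge 1$ and let $U_1,\dots,U_n$ be finite sets with $|U_h|\ge 2$. Put $X=U_1\times\cdots\times U_n$ and $E=\{0,1\}^n$. For $\mathbf g\in E$ let $S(\mathbf g)=\{a:\mathbf g_a=1\}$, $R_{\mathbf g}=\{(\mathbf y,\mathbf z)\in X\times X:\ \mathbf y_a\neq\mathbf z_a\iff\mathbf g_a=1\}$ (the factorial scheme, i.e. the direct product of the trivial schemes on the $U_h$), and $k_{\mathbf g}=\prod_{a\in S(\mathbf g)}(|U_a|-1)$ ($k_{\mathbf 0}=1$). Let $A_{\mathbf g}\in\mathrm{M}_X(\mathbb{F})$ be the $\{0,1\}$ adjacency matrix of $R_{\mathbf g}$. Fix $\mathbf x\in X$ and let $E^*_{\mathbf g}$ be the diagonal matrix with $(\mathbf y,\mathbf y)$-entry $1$ iff $(\mathbf x,\mathbf y)\in R_{\mathbf g}$, else $0$. $\mathbb{T}$ is the $\mathbb{F}$-subalgebra of $\mathrm{M}_X(\mathbb{F})$ generated by all $A_{\mathbf g},E^*_{\mathbf g}$ (the Terwilliger algebra with respect to $\mathbf x$). *)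

theory Defs
  imports "HOL-Algebra.Module" "HOL-Algebra.Subrings" "HOL-Library.FuncSet"
begin

section \<open>Semisimple algebras\<close>

text \<open>
  Algebras over a field, given as a type of class \<open>field\<close>, are represented by
  the library's \<open>module\<close> records, which carry both the ring operations and the
  scalar multiplication. All algebras are unital, so the left ideals of the
  underlying ring are precisely the submodules of the left regular module; they are
  automatically closed under scalars.
\<close>

definition left_ideal :: "'a set \<Rightarrow> ('a, 'm) ring_scheme \<Rightarrow> bool" where
  "left_ideal I R \<longleftrightarrow>
     subgroup I (add_monoid R) \<and> (\<forall>r \<in> carrier R. \<forall>a \<in> I. r \<otimes>\<^bsub>R\<^esub> a \<in> I)"

definition simple_left_ideal :: "'a set \<Rightarrow> ('a, 'm) ring_scheme \<Rightarrow> bool" where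
  "simple_left_ideal I R \<longleftrightarrow>
     left_ideal I R \<and> I \<noteq> {\<zero>\<^bsub>R\<^esub>} \<and>
     (\<forall>J. left_ideal J R \<and> J \<subseteq> I \<longrightarrow> J = {\<zero>\<^bsub>R\<^esub>} \<or> J = I)"

text \<open>
  The left regular module is an internal direct sum of simple submodules. A finite
  family is no restriction: in any decomposition of a unital ring as a direct sum of
  left ideals, only finitely many summands are nonzero.
\<close>

definition semisimple :: "('a, 'm) ring_scheme \<Rightarrow> bool" where
  "semisimple R \<longleftrightarrow>
     (\<exists>(m::nat) L. (\<forall>i<m. simple_left_ideal (L i) R) \<and>
        (\<forall>a \<in> carrier R. \<exists>!f. f \<in> (\<Pi>\<^sub>E i\<in>{..<m}. L i) \<and> a = (\<Oplus>\<^bsub>R\<^esub>i\<in>{..<m}. f i)))"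

definition is_subalgebra :: "('f::field, 'a, 'm) module_scheme \<Rightarrow> 'a set \<Rightarrow> bool" where
  "is_subalgebra A B \<longleftrightarrow> subring B A \<and> (\<forall>c. \<forall>b \<in> B. c \<odot>\<^bsub>A\<^esub> b \<in> B)"

definition generated_subalgebra ::
    "('f::field, 'a, 'm) module_scheme \<Rightarrow> 'a set \<Rightarrow> ('f, 'a, 'm) module_scheme" where
  "generated_subalgebra A G = A\<lparr>carrier := is_subalgebra A hull G\<rparr>"

section \<open>Matrices indexed by a set\<close>

text \<open>
  Entries outside \<open>X \<times> X\<close> are fixed to be \<open>0\<close>, so that matrices over \<open>X\<close> are
  equal as functions iff their entries over \<open>X\<close> agree.
\<close>

definition mat_algebra :: "'x set \<Rightarrow> ('f::field, 'x \<Rightarrow> 'x \<Rightarrow> 'f) module" where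
  "mat_algebra X =
     \<lparr>carrier = {M. \<forall>y z. y \<notin> X \<or> z \<notin> X \<longrightarrow> M y z = 0},
      mult = (\<lambda>M N y z. \<Sum>w\<in>X. M y w * N w z),
      one = (\<lambda>y z. of_bool (y \<in> X \<and> y = z)),
      zero = (\<lambda>y z. 0),
      add = (\<lambda>M N y z. M y z + N y z),
      smult = (\<lambda>c M y z. c * M y z)\<rparr>"

section \<open>Factorial schemes and their Terwilliger algebras\<close>

definition fact_points :: "nat \<Rightarrow> (nat \<Rightarrow> 'u set) \<Rightarrow> (nat \<Rightarrow> 'u) set" where
  "fact_points n U = (\<Pi>\<^sub>E h\<in>{1..n}. U h)"

definition fact_index :: "nat \<Rightarrow> (nat \<Rightarrow> nat) set" where
  "fact_index n = (\<Pi>\<^sub>E h\<in>{1..n}. {0, 1})"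

definition index_support :: "nat \<Rightarrow> (nat \<Rightarrow> nat) \<Rightarrow> nat set" where
  "index_support n g = {a \<in> {1..n}. g a = 1}"

definition fact_rel ::
    "nat \<Rightarrow> (nat \<Rightarrow> 'u set) \<Rightarrow> (nat \<Rightarrow> nat) \<Rightarrow> ((nat \<Rightarrow> 'u) \<times> (nat \<Rightarrow> 'u)) set" where
  "fact_rel n U g =
     {(y, z) \<in> fact_points n U \<times> fact_points n U. \<forall>a \<in> {1..n}. y a \<noteq> z a \<longleftrightarrow> g a = 1}"

definition fact_valency :: "nat \<Rightarrow> (nat \<Rightarrow> 'u set) \<Rightarrow> (nat \<Rightarrow> nat) \<Rightarrow> nat" where
  "fact_valency n U g = (\<Prod>a \<in> index_support n g. card (U a) - 1)"

definition adj_mat ::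
    "nat \<Rightarrow> (nat \<Rightarrow> 'u set) \<Rightarrow> (nat \<Rightarrow> nat) \<Rightarrow> (nat \<Rightarrow> 'u) \<Rightarrow> (nat \<Rightarrow> 'u) \<Rightarrow> 'f::field" where
  "adj_mat n U g = (\<lambda>y z. of_bool ((y, z) \<in> fact_rel n U g))"

definition dual_idem ::
    "nat \<Rightarrow> (nat \<Rightarrow> 'u set) \<Rightarrow> (nat \<Rightarrow> 'u) \<Rightarrow> (nat \<Rightarrow> nat) \<Rightarrow>
     (nat \<Rightarrow> 'u) \<Rightarrow> (nat \<Rightarrow> 'u) \<Rightarrow> 'f::field" where
  "dual_idem n U x g = (\<lambda>y z. of_bool (y = z \<and> (x, y) \<in> fact_rel n U g))"

definition terwilliger_algebra ::
    "nat \<Rightarrow> (nat \<Rightarrow> 'u set) \<Rightarrow> (nat \<Rightarrow> 'u) \<Rightarrow>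
     ('f::field, (nat \<Rightarrow> 'u) \<Rightarrow> (nat \<Rightarrow> 'u) \<Rightarrow> 'f) module" where
  "terwilliger_algebra n U x =
     generated_subalgebra (mat_algebra (fact_points n U))
       (adj_mat n U ` fact_index n \<union> dual_idem n U x ` fact_index n)"

text \<open>
  For \<open>p\<close> the characteristic of the field \<open>'f\<close>, the condition \<open>p \<nmid> m\<close> means that
  \<open>m\<close> has nonzero image in \<open>'f\<close>.
\<close>

definition p'_valenced :: "'f::field itself \<Rightarrow> nat \<Rightarrow> (nat \<Rightarrow> 'u set) \<Rightarrow> bool" where
  "p'_valenced _ n U \<longleftrightarrow> (\<forall>g \<in> fact_index n. (of_nat (fact_valency n U g) :: 'f) \<noteq> 0)"

end

theory Submission
  imports Defs
begin

text \<open>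
  The Terwilliger algebra is the tensor product of the Terwilliger algebras of the trivial
  schemes on the factors \<open>U h\<close>. Write \<open>E\<^sub>0\<close>, \<open>E\<^sub>1\<close> for the two dual idempotents of a factor
  with \<open>m\<close> points and \<open>J\<close> for its all-ones matrix.

  If \<open>m - 1\<close> is invertible, \<open>E\<^sub>0\<close>, \<open>E\<^sub>0 J E\<^sub>1\<close>, \<open>E\<^sub>1 J E\<^sub>0 / (m - 1)\<close>, \<open>E\<^sub>1 J E\<^sub>1 / (m - 1)\<close> are
  matrix units of a two-by-two block, and \<open>E\<^sub>1 - E\<^sub>1 J E\<^sub>1 / (m - 1)\<close> is a complementary
  idempotent with one-dimensional corner. Tensoring these yields orthogonal idempotents \<open>e c\<close>
  with sum \<open>1\<close> such that every nonzero element of \<open>(e c) T (e d)\<close> can be multiplied from the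
  left to \<open>e d\<close>; hence the left ideals \<open>T (e d)\<close> are simple or zero and \<open>T\<close> is their direct sum.

  If \<open>m - 1\<close> vanishes for some factor, let \<open>a\<close> be \<open>E\<^sub>1 J E\<^sub>1\<close> on that factor and the identity
  on the others. Elements of \<open>T\<close> are invariant under permutations of that factor fixing the
  base point, so \<open>a t a\<close> is a multiple of \<open>m - 1\<close> for all \<open>t\<close> in \<open>T\<close>. A semisimple ring has no
  nonzero element with this property.
\<close>

section \<open>Semisimple rings\<close>

context ring
begin

lemma left_ideal_principal:
  assumes "e \<in> carrier R"
  shows "left_ideal ((\<lambda>t. t \<otimes> e) ` carrier R) R"
  unfolding left_ideal_def
proof (intro conjI ballI)
  show "subgroup ((\<lambda>t. t \<otimes> e) ` carrier R) (add_monoid R)"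
  proof (rule add.subgroupI)
    show "\<ominus> s \<in> (\<lambda>t. t \<otimes> e) ` carrier R" if s: "s \<in> (\<lambda>t. t \<otimes> e) ` carrier R" for s
    proof -
      obtain t where "t \<in> carrier R" "s = t \<otimes> e" using s by auto
      then show ?thesis using assms by (auto simp: l_minus[symmetric])
    qed
  qed (use assms in \<open>auto simp: l_distr[symmetric]\<close>)
qed (use assms in \<open>auto simp: m_assoc[symmetric]\<close>)

text \<open>If \<open>a\<close> did not kill some \<open>v\<close> in a simple summand, then
  \<open>a \<otimes> v\<close> would generate that summand. So
  \<open>v = t \<otimes> (a \<otimes> v)\<close> for some \<open>t\<close>, and multiplying by
  \<open>a\<close> expresses \<open>a \<otimes> v\<close> through
  \<open>a \<otimes> t \<otimes> a\<close>, which is zero. Hence \<open>a\<close> kills every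
  summand, and writing \<open>\<one>\<close> as a sum of elements of the summands gives
  \<open>a = \<zero>\<close>.\<close>

lemma semisimple_imp_semiprime:
  assumes ss: "semisimple R" and a: "a \<in> carrier R"
    and ann: "\<And>t. t \<in> carrier R \<Longrightarrow> a \<otimes> t \<otimes> a = \<zero>"
  shows "a = \<zero>"
proof -
  obtain m :: nat and L where L: "\<And>i. i < m \<Longrightarrow> simple_left_ideal (L i) R"
    and dec: "\<forall>b \<in> carrier R. \<exists>!f. f \<in> (\<Pi>\<^sub>E i\<in>{..<m}. L i) \<and> b = (\<Oplus>i\<in>{..<m}. f i)"
    using ss unfolding semisimple_def by blast
  have sub: "L i \<subseteq> carrier R" if "i < m" for i
    using L[OF that] subgroup.subset unfolding simple_left_ideal_def left_ideal_def
    by fastforce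
  have kill: "a \<otimes> v = \<zero>" if i: "i < m" and v: "v \<in> L i" for i v
  proof (rule ccontr)
    assume nz: "a \<otimes> v \<noteq> \<zero>"
    have vc: "v \<in> carrier R" using sub[OF i] v by blast
    have li: "left_ideal (L i) R" using L[OF i] by (simp add: simple_left_ideal_def)
    define J where "J = (\<lambda>t. t \<otimes> (a \<otimes> v)) ` carrier R"
    have J: "left_ideal J R" unfolding J_def by (rule left_ideal_principal) (use a vc in simp)
    have "a \<otimes> v \<in> L i" using li a v by (simp add: left_ideal_def)
    then have "J \<subseteq> L i" using li by (auto simp: left_ideal_def J_def)
    moreover have "a \<otimes> v \<in> J" unfolding J_def using a vc by (intro image_eqI[of _ _ \<one>]) auto
    ultimately have "J = L i" using J L[OF i] nz unfolding simple_left_ideal_def by blast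
    then obtain t where t: "t \<in> carrier R" "v = t \<otimes> (a \<otimes> v)" using v by (auto simp: J_def)
    then have "a \<otimes> v = (a \<otimes> t \<otimes> a) \<otimes> v" using a vc by (metis m_assoc m_closed)
    then show False using ann[OF t(1)] nz vc by simp
  qed
  obtain f where f: "f \<in> (\<Pi>\<^sub>E i\<in>{..<m}. L i)" "\<one> = (\<Oplus>i\<in>{..<m}. f i)"
    using dec by blast
  have fL: "f i \<in> L i" if "i < m" for i using f that by auto
  have fc: "f \<in> {..<m} \<rightarrow> carrier R" using fL sub by blast
  have "a = a \<otimes> (\<Oplus>i\<in>{..<m}. f i)" using a f(2)[symmetric] by simp
  also have "\<dots> = (\<Oplus>i\<in>{..<m}. a \<otimes> f i)" by (rule finsum_rdistr) (use a fc in auto)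
  also have "\<dots> = (\<Oplus>i\<in>{..<m}. \<zero>)"
    by (rule add.finprod_cong') (use kill fL in auto)
  finally show ?thesis by simp
qed

text \<open>The summands are the left ideals generated by the nonzero \<open>e i\<close>.
  Orthogonality and the sum condition make the decomposition direct. The hypothesis
  \<open>ret\<close> makes each summand simple, because a nonzero element of a smaller left ideal
  has a nonzero component \<open>e j \<otimes> v\<close>, which can be multiplied back to the
  generator.\<close>

lemma semisimple_of_orthogonal_idempotents:
  fixes e :: "'i \<Rightarrow> 'a"
  assumes fin: "finite I" and e: "\<And>i. i \<in> I \<Longrightarrow> e i \<in> carrier R"
    and orth: "\<And>i j. i \<in> I \<Longrightarrow> j \<in> I \<Longrightarrow> e i \<otimes> e j = (if i = j then e i else \<zero>)"
    and one: "(\<Oplus>i\<in>I. e i) = \<one>"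
    and ret: "\<And>i j t. i \<in> I \<Longrightarrow> j \<in> I \<Longrightarrow> t \<in> carrier R \<Longrightarrow> e i \<otimes> t \<otimes> e j \<noteq> \<zero>
                \<Longrightarrow> \<exists>s \<in> carrier R. s \<otimes> (e i \<otimes> t \<otimes> e j) = e j"
  shows "semisimple R"
proof -
  \<comment> \<open>A vanishing idempotent generates the zero ideal, which is not simple. Such
    indices are dropped and the rest renumbered by an initial segment of the naturals, as
    \<open>semisimple\<close> requires.\<close>
  define K where "K = {i \<in> I. e i \<noteq> \<zero>}"
  have K: "K \<subseteq> I" "finite K" using fin by (auto simp: K_def)
  obtain h where h: "bij_betw h {0..<card K} K" using ex_bij_betw_nat_finite[OF K(2)] by blast
  define m where "m = card K"
  define d where "d i = e (h i)" for i
  have hK: "h i \<in> K" if "i < m" for i using h that by (auto simp: bij_betw_def m_def)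
  then have hI: "h i \<in> I" if "i < m" for i using that K by blast
  have inj: "inj_on h {..<m}" "h ` {..<m} = K"
    using h by (auto simp: bij_betw_def m_def atLeast0LessThan)
  have d: "d i \<in> carrier R" "d i \<noteq> \<zero>" if "i < m" for i
    using hK[OF that] e by (auto simp: K_def d_def)
  have dorth: "d i \<otimes> d j = (if i = j then d i else \<zero>)" if "i < m" "j < m" for i j
    using orth[OF hI hI, OF that] inj(1) that by (auto simp: d_def inj_on_def)
  have "e \<in> K \<rightarrow> carrier R" using K e by blast
  then have "(\<Oplus>i\<in>{..<m}. d i) = (\<Oplus>i\<in>K. e i)"
    using add.finprod_reindex[OF _ inj(1), of e] by (simp add: inj(2) d_def)
  also have "\<dots> = (\<Oplus>i\<in>I. e i)"
    by (rule add.finprod_mono_neutral_cong_left) (use fin e in \<open>auto simp: K_def\<close>)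
  finally have dsum: "(\<Oplus>i\<in>{..<m}. d i) = \<one>" using one by simp
  define L where "L i = (\<lambda>t. t \<otimes> d i) ` carrier R" for i
  have fixL: "v \<otimes> d i = v" if "i < m" "v \<in> L i" for i v
    using that d dorth[OF that(1) that(1)] by (auto simp: L_def m_assoc)
  have simple: "simple_left_ideal (L i) R" if i: "i < m" for i
    unfolding simple_left_ideal_def
  proof (intro conjI allI impI)
    show "left_ideal (L i) R" unfolding L_def by (rule left_ideal_principal[OF d(1)[OF i]])
    have "d i \<in> L i" unfolding L_def using d[OF i] by (intro image_eqI[of _ _ \<one>]) auto
    then show "L i \<noteq> {\<zero>}" using d(2)[OF i] by blast
    fix J assume J: "left_ideal J R \<and> J \<subseteq> L i"
    then have sg: "subgroup J (add_monoid R)" by (simp add: left_ideal_def)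
    have z: "\<zero> \<in> J" using subgroup.one_closed[OF sg] by simp
    show "J = {\<zero>} \<or> J = L i"
    proof (rule disjCI)
      assume "J \<noteq> L i"
      show "J = {\<zero>}"
      proof (rule ccontr)
        assume "J \<noteq> {\<zero>}"
        then obtain v where v: "v \<in> J" "v \<noteq> \<zero>" using z by blast
        have vc: "v \<in> carrier R" using subgroup.subset[OF sg] v by auto
        have vi: "v \<otimes> d i = v" using fixL[OF i] J v by blast
        have "v = (\<Oplus>j\<in>I. e j) \<otimes> v" using one vc by simp
        also have "\<dots> = (\<Oplus>j\<in>I. e j \<otimes> v)" by (rule finsum_ldistr) (use fin e vc in auto)
        finally have vsum: "v = (\<Oplus>j\<in>I. e j \<otimes> v)" .
        \<comment> \<open>The idempotents sum to \<open>\<one>\<close>, so a nonzero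
          \<open>v\<close> cannot be killed by all of them.\<close>
        have "\<exists>j\<in>I. e j \<otimes> v \<noteq> \<zero>"
        proof (rule ccontr)
          assume "\<not> ?thesis"
          then have "(\<Oplus>j\<in>I. e j \<otimes> v) = (\<Oplus>j\<in>I. \<zero>)" by (intro add.finprod_cong') auto
          then show False using vsum v(2) by simp
        qed
        then obtain j where j: "j \<in> I" "e j \<otimes> v \<noteq> \<zero>" by blast
        have eq: "e j \<otimes> v \<otimes> e (h i) = e j \<otimes> v"
          using vi e[OF j(1)] vc d[OF i] by (simp add: m_assoc d_def)
        then obtain s where s: "s \<in> carrier R" "s \<otimes> (e j \<otimes> v) = d i"
          using ret[OF j(1) hI[OF i] vc] j(2) by (auto simp: d_def)
        have "s \<otimes> (e j \<otimes> v) \<in> J"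
          using J v(1) e[OF j(1)] s(1) by (simp add: left_ideal_def)
        then have "d i \<in> J" by (simp only: s(2))
        then have "L i \<subseteq> J" using J by (auto simp: L_def left_ideal_def)
        then show False using \<open>J \<noteq> L i\<close> J by blast
      qed
    qed
  qed
  have "\<exists>!f. f \<in> (\<Pi>\<^sub>E i\<in>{..<m}. L i) \<and> a = (\<Oplus>i\<in>{..<m}. f i)" if a: "a \<in> carrier R" for a
  proof (rule ex1I)
    let ?f = "restrict (\<lambda>i. a \<otimes> d i) {..<m}"
    have "a = a \<otimes> (\<Oplus>i\<in>{..<m}. d i)" using a dsum by simp
    also have "\<dots> = (\<Oplus>i\<in>{..<m}. a \<otimes> d i)" by (rule finsum_rdistr) (use a d in auto)
    also have "\<dots> = (\<Oplus>i\<in>{..<m}. ?f i)" by (rule add.finprod_cong') (use a d in auto)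
    finally show "?f \<in> (\<Pi>\<^sub>E i\<in>{..<m}. L i) \<and> a = (\<Oplus>i\<in>{..<m}. ?f i)"
      using a by (auto simp: L_def)
    fix f assume f: "f \<in> (\<Pi>\<^sub>E i\<in>{..<m}. L i) \<and> a = (\<Oplus>i\<in>{..<m}. f i)"
    then have fL: "f i \<in> L i" if "i < m" for i using that by auto
    then have fc: "f i \<in> carrier R" if "i < m" for i using fL[OF that] d(1)[OF that] by (auto simp: L_def)
    have "f j = a \<otimes> d j" if j: "j < m" for j
    proof -
      \<comment> \<open>Right multiplication by \<open>d j\<close> is the projection onto the
        \<open>j\<close>-th summand, so it recovers the component \<open>f j\<close> from
        \<open>a\<close>; this gives uniqueness.\<close>
      have step: "f i \<otimes> d j = (if j = i then f i else \<zero>)" if i: "i < m" for i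
      proof -
        have "f i \<otimes> d j = f i \<otimes> (d i \<otimes> d j)"
          using fixL[OF i fL[OF i]] m_assoc[OF fc[OF i] d(1)[OF i] d(1)[OF j]] by simp
        then show ?thesis using dorth[OF i j] fixL[OF i fL[OF i]] fc[OF i] by auto
      qed
      have "a \<otimes> d j = (\<Oplus>i\<in>{..<m}. f i \<otimes> d j)"
        unfolding conjunct2[OF f] by (rule finsum_ldistr) (use d[OF j] fc in auto)
      also have "\<dots> = (\<Oplus>i\<in>{..<m}. if j = i then f i else \<zero>)"
        by (rule add.finprod_cong') (use step fc in auto)
      also have "\<dots> = f j" by (rule add.finprod_singleton) (use j fc in auto)
      finally show ?thesis by simp
    qed
    moreover have "f \<in> extensional {..<m}" using f by (simp add: PiE_def)
    ultimately show "f = ?f" by (intro extensionalityI[of f "{..<m}"]) simp_all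
  qed
  then show ?thesis
    unfolding semisimple_def using simple by (intro exI[of _ m] exI[of _ L] conjI) auto
qed

end

section \<open>Subalgebras of matrix algebras\<close>

lemma mat_algebra_simps:
  "carrier (mat_algebra X) = {M. \<forall>y z. y \<notin> X \<or> z \<notin> X \<longrightarrow> M y z = 0}"
  "M \<otimes>\<^bsub>mat_algebra X\<^esub> N = (\<lambda>y z. \<Sum>w\<in>X. M y w * N w z)"
  "\<one>\<^bsub>mat_algebra X\<^esub> = (\<lambda>y z. of_bool (y \<in> X \<and> y = z))"
  "\<zero>\<^bsub>mat_algebra X\<^esub> = (\<lambda>y z. 0)"
  "M \<oplus>\<^bsub>mat_algebra X\<^esub> N = (\<lambda>y z. M y z + N y z)"
  "c \<odot>\<^bsub>mat_algebra X\<^esub> M = (\<lambda>y z. c * M y z)"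
  by (simp_all add: mat_algebra_def)

lemma ring_mat_algebra:
  assumes "finite X"
  shows "ring (mat_algebra X :: ('f::field, 'x \<Rightarrow> 'x \<Rightarrow> 'f) module)"
proof (rule ringI)
  show "abelian_group (mat_algebra X :: ('f, 'x \<Rightarrow> 'x \<Rightarrow> 'f) module)"
  proof (rule abelian_groupI)
    fix M :: "'x \<Rightarrow> 'x \<Rightarrow> 'f" assume "M \<in> carrier (mat_algebra X)"
    then show "\<exists>N\<in>carrier (mat_algebra X). N \<oplus>\<^bsub>mat_algebra X\<^esub> M = \<zero>\<^bsub>mat_algebra X\<^esub>"
      by (intro bexI[of _ "\<lambda>y z. - M y z"]) (auto simp: mat_algebra_simps)
  qed (auto simp: mat_algebra_simps ac_simps)
  show "monoid (mat_algebra X :: ('f, 'x \<Rightarrow> 'x \<Rightarrow> 'f) module)"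
  proof (rule monoidI)
    fix M N P :: "'x \<Rightarrow> 'x \<Rightarrow> 'f"
    show "M \<otimes>\<^bsub>mat_algebra X\<^esub> N \<otimes>\<^bsub>mat_algebra X\<^esub> P = M \<otimes>\<^bsub>mat_algebra X\<^esub> (N \<otimes>\<^bsub>mat_algebra X\<^esub> P)"
      unfolding mat_algebra_simps
      by (intro ext, simp add: sum_distrib_left sum_distrib_right mult.assoc, rule sum.swap)
  next
    fix M :: "'x \<Rightarrow> 'x \<Rightarrow> 'f" assume M: "M \<in> carrier (mat_algebra X)"
    have "(\<Sum>w\<in>X. of_bool (y \<in> X \<and> y = w) * M w z) = (\<Sum>w\<in>X. if y = w then M w z else 0)"
      for y z by (rule sum.cong) auto
    then show "\<one>\<^bsub>mat_algebra X\<^esub> \<otimes>\<^bsub>mat_algebra X\<^esub> M = M"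
      using M assms by (auto simp: mat_algebra_simps fun_eq_iff)
    have "(\<Sum>w\<in>X. M y w * of_bool (w \<in> X \<and> w = z)) = (\<Sum>w\<in>X. if w = z then M y w else 0)"
      for y z by (rule sum.cong) auto
    then show "M \<otimes>\<^bsub>mat_algebra X\<^esub> \<one>\<^bsub>mat_algebra X\<^esub> = M"
      using M assms by (auto simp: mat_algebra_simps fun_eq_iff)
  qed (auto simp: mat_algebra_simps)
qed (auto simp: mat_algebra_simps distrib_left distrib_right sum.distrib)

lemma mat_algebra_a_inv:
  assumes "finite X" "M \<in> carrier (mat_algebra X)"
  shows "\<ominus>\<^bsub>mat_algebra X\<^esub> M = (\<lambda>y z. - M y z :: 'f::field)"
proof -
  interpret ring "mat_algebra X :: ('f, 'a \<Rightarrow> 'a \<Rightarrow> 'f) module" by (rule ring_mat_algebra[OF assms(1)])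
  show ?thesis
    by (rule minus_equality) (use assms in \<open>auto simp: mat_algebra_simps\<close>)
qed

text \<open>Reduces later closure proofs to entrywise conditions. Additive inverses come from
  scaling by \<open>-1\<close>, and so get no condition of their own.\<close>

lemma is_subalgebra_mat_algebra_iff:
  assumes "finite X"
  shows "is_subalgebra (mat_algebra X) B \<longleftrightarrow>
     B \<subseteq> carrier (mat_algebra X) \<and> (\<lambda>y z. of_bool (y \<in> X \<and> y = z)) \<in> B \<and>
     (\<forall>M\<in>B. \<forall>N\<in>B. (\<lambda>y z. M y z + N y z) \<in> B \<and> (\<lambda>y z. \<Sum>w\<in>X. M y w * N w z) \<in> B) \<and>
     (\<forall>c. \<forall>M\<in>B. (\<lambda>y z. c * M y z :: 'f::field) \<in> B)"
    (is "?L \<longleftrightarrow> ?R")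
proof
  interpret ring "mat_algebra X :: ('f, 'a \<Rightarrow> 'a \<Rightarrow> 'f) module" by (rule ring_mat_algebra[OF assms(1)])
  show ?R if L: ?L
  proof -
    have "subring B (mat_algebra X)" using L by (simp add: is_subalgebra_def)
    from subringE(1,3,6,7)[OF this] show ?thesis
      using L by (simp add: is_subalgebra_def mat_algebra_simps)
  qed
  show ?L if R: ?R
    unfolding is_subalgebra_def
  proof (intro conjI)
    show "subring B (mat_algebra X)"
    proof (rule subringI)
      fix M assume M: "M \<in> B"
      have "(\<lambda>y z. (-1) * M y z) \<in> B" using R M by blast
      moreover have "M \<in> carrier (mat_algebra X)" using R M by blast
      ultimately show "\<ominus>\<^bsub>mat_algebra X\<^esub> M \<in> B" by (simp add: mat_algebra_a_inv[OF assms])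
    qed (use R in \<open>auto simp: mat_algebra_simps\<close>)
  qed (use R in \<open>auto simp: mat_algebra_simps\<close>)
qed

lemma is_subalgebra_carrier:
  "finite X \<Longrightarrow> is_subalgebra (mat_algebra X) (carrier (mat_algebra X))"
  by (auto simp: is_subalgebra_mat_algebra_iff mat_algebra_simps)

lemma
  assumes "finite X" "is_subalgebra (mat_algebra X) B"
  shows is_subalgebra_one: "(\<lambda>y z. of_bool (y \<in> X \<and> y = z)) \<in> B"
    and is_subalgebra_add: "M \<in> B \<Longrightarrow> N \<in> B \<Longrightarrow> (\<lambda>y z. M y z + N y z) \<in> B"
    and is_subalgebra_mult: "M \<in> B \<Longrightarrow> N \<in> B \<Longrightarrow> (\<lambda>y z. \<Sum>w\<in>X. M y w * N w z) \<in> B"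
    and is_subalgebra_smult: "M \<in> B \<Longrightarrow> (\<lambda>y z. c * M y z :: 'f::field) \<in> B"
  using is_subalgebra_mat_algebra_iff[OF assms(1), THEN iffD1, OF assms(2)] by simp_all

text \<open>The hull is the intersection of all subalgebras containing \<open>G\<close>, and each
  closure condition passes to intersections. The full matrix algebra is one of the intersected sets,
  which keeps the hull inside the carrier.\<close>

lemma is_subalgebra_hull:
  assumes X: "finite X" and G: "G \<subseteq> carrier (mat_algebra X)"
  shows "is_subalgebra (mat_algebra X) (is_subalgebra (mat_algebra X) hull G)" (is "is_subalgebra _ ?H")
proof -
  have mem: "M \<in> ?H \<longleftrightarrow> (\<forall>B. is_subalgebra (mat_algebra X) B \<and> G \<subseteq> B \<longrightarrow> M \<in> B)" for M
    by (auto simp: hull_def)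
  show ?thesis
  proof (rule is_subalgebra_mat_algebra_iff[OF X, THEN iffD2], intro conjI ballI allI)
    show "?H \<subseteq> carrier (mat_algebra X)"
      using hull_minimal[of G _ "is_subalgebra (mat_algebra X)", OF G is_subalgebra_carrier[OF X]] .
  qed (use mem in \<open>simp_all add: is_subalgebra_one[OF X] is_subalgebra_add[OF X]
         is_subalgebra_mult[OF X] is_subalgebra_smult[OF X]\<close>)
qed

lemma is_subalgebra_sum:
  assumes "finite X" "is_subalgebra (mat_algebra X) B" "\<And>i. i \<in> A \<Longrightarrow> M i \<in> B"
  shows "(\<lambda>y z. \<Sum>i\<in>A. M i y z :: 'f::field) \<in> B"
proof -
  have z: "(\<lambda>y z. 0) \<in> B"
    using is_subalgebra_smult[OF assms(1,2) is_subalgebra_one[OF assms(1,2)], of 0] by simp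
  show ?thesis using assms(3)
  proof (induction A rule: infinite_finite_induct)
    case (insert i A)
    then have "(\<lambda>y z. M i y z + (\<Sum>i\<in>A. M i y z)) \<in> B"
      by (intro is_subalgebra_add[OF assms(1,2)]) auto
    then show ?case using insert by simp
  qed (use z in simp_all)
qed

text \<open>Translates the abstract sums in the definition of semisimplicity into sums of entries.
  For an infinite index set both sides are zero by convention.\<close>

lemma finsum_subalgebra:
  assumes X: "finite X" and B: "is_subalgebra (mat_algebra X) B"
    and f: "\<And>i. i \<in> A \<Longrightarrow> f i \<in> B"
  shows "finsum (mat_algebra X\<lparr>carrier := B\<rparr>) f A = (\<lambda>y z. \<Sum>i\<in>A. f i y z :: 'f::field)"
proof -
  have "subring B (mat_algebra X)" using B by (simp add: is_subalgebra_def)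
  then interpret ring "mat_algebra X\<lparr>carrier := B\<rparr>"
    by (rule ring.subring_is_ring[OF ring_mat_algebra[OF X]])
  show ?thesis using f
  proof (induction A rule: infinite_finite_induct)
    case (insert i A)
    then have "finsum (mat_algebra X\<lparr>carrier := B\<rparr>) f (insert i A)
        = f i \<oplus>\<^bsub>mat_algebra X\<lparr>carrier := B\<rparr>\<^esub> finsum (mat_algebra X\<lparr>carrier := B\<rparr>) f A"
      by (intro finsum_insert) auto
    then show ?case using insert by (simp add: mat_algebra_simps)
  qed (simp_all add: mat_algebra_simps)
qed

lemma finsum_mat_algebra:
  assumes "finite X" "\<And>i. i \<in> A \<Longrightarrow> f i \<in> carrier (mat_algebra X)"
  shows "finsum (mat_algebra X) f A = (\<lambda>y z. \<Sum>i\<in>A. f i y z :: 'f::field)"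
  using finsum_subalgebra[OF assms(1) is_subalgebra_carrier[OF assms(1)] assms(2)] by simp

text \<open>Matrices whose Peirce components all lie on prescribed lines form a subalgebra:
  inserting \<open>\<one>\<close> as the sum of the \<open>e k\<close> between \<open>s\<close> and
  \<open>t\<close> writes a component of the product as a sum of products of components, and
  \<open>u\<close> keeps each of these on the right line. A bound on the components of a generated
  algebra can thus be checked on generators.\<close>

lemma is_subalgebra_peirce_lines:
  fixes e :: "'i \<Rightarrow> 'x \<Rightarrow> 'x \<Rightarrow> 'f::field" and X :: "'x set"
  defines "R \<equiv> mat_algebra X :: ('f, 'x \<Rightarrow> 'x \<Rightarrow> 'f) module"
  assumes X: "finite X" and I: "finite I"
    and e: "\<And>i. i \<in> I \<Longrightarrow> e i \<in> carrier R"
    and idem: "\<And>i. i \<in> I \<Longrightarrow> e i \<otimes>\<^bsub>R\<^esub> e i = e i"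
    and one: "finsum R e I = \<one>\<^bsub>R\<^esub>"
    and unit: "\<And>i j. i \<in> I \<Longrightarrow> j \<in> I \<Longrightarrow> \<exists>c. e i \<otimes>\<^bsub>R\<^esub> e j = c \<odot>\<^bsub>R\<^esub> u i j"
    and u: "\<And>i j k. i \<in> I \<Longrightarrow> j \<in> I \<Longrightarrow> k \<in> I \<Longrightarrow> \<exists>c. u i j \<otimes>\<^bsub>R\<^esub> u j k = c \<odot>\<^bsub>R\<^esub> u i k"
  shows "is_subalgebra R
    {t \<in> carrier R. \<forall>i\<in>I. \<forall>j\<in>I. \<exists>c. e i \<otimes>\<^bsub>R\<^esub> t \<otimes>\<^bsub>R\<^esub> e j = c \<odot>\<^bsub>R\<^esub> u i j}" (is "is_subalgebra R ?D")
proof -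
  interpret ring R unfolding R_def by (rule ring_mat_algebra[OF X])
  have smm: "(a \<odot>\<^bsub>R\<^esub> M) \<otimes>\<^bsub>R\<^esub> (b \<odot>\<^bsub>R\<^esub> N) = (a * b) \<odot>\<^bsub>R\<^esub> (M \<otimes>\<^bsub>R\<^esub> N)" for a b M N
    by (simp add: R_def mat_algebra_simps sum_distrib_left mult.assoc mult.left_commute)
  have sml: "(a \<odot>\<^bsub>R\<^esub> M) \<otimes>\<^bsub>R\<^esub> N = a \<odot>\<^bsub>R\<^esub> (M \<otimes>\<^bsub>R\<^esub> N)" for a M N
    by (simp add: R_def mat_algebra_simps sum_distrib_left mult.assoc mult.left_commute)
  have smr: "M \<otimes>\<^bsub>R\<^esub> (a \<odot>\<^bsub>R\<^esub> N) = a \<odot>\<^bsub>R\<^esub> (M \<otimes>\<^bsub>R\<^esub> N)" for a M N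
    by (simp add: R_def mat_algebra_simps sum_distrib_left mult.assoc mult.left_commute)
  have sma: "a \<odot>\<^bsub>R\<^esub> (b \<odot>\<^bsub>R\<^esub> M) = (a * b) \<odot>\<^bsub>R\<^esub> M" for a b M
    by (simp add: R_def mat_algebra_simps ac_simps)
  have add: "(a \<odot>\<^bsub>R\<^esub> M) \<oplus>\<^bsub>R\<^esub> (b \<odot>\<^bsub>R\<^esub> M) = (a + b) \<odot>\<^bsub>R\<^esub> M" for a b M
    by (simp add: R_def mat_algebra_simps distrib_right)
  have smc: "c \<odot>\<^bsub>R\<^esub> M \<in> carrier R" if "M \<in> carrier R" for c M
    using that by (auto simp: R_def mat_algebra_simps)
  have prod: "\<exists>c. e i \<otimes>\<^bsub>R\<^esub> (s \<otimes>\<^bsub>R\<^esub> t) \<otimes>\<^bsub>R\<^esub> e j = c \<odot>\<^bsub>R\<^esub> u i j"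
    if D: "s \<in> ?D" "t \<in> ?D" and ij: "i \<in> I" "j \<in> I" for s t i j
  proof -
    have c: "s \<in> carrier R" "t \<in> carrier R" "e i \<in> carrier R" "e j \<in> carrier R"
      using D e ij by auto
    have "e i \<otimes>\<^bsub>R\<^esub> (s \<otimes>\<^bsub>R\<^esub> t) \<otimes>\<^bsub>R\<^esub> e j = e i \<otimes>\<^bsub>R\<^esub> s \<otimes>\<^bsub>R\<^esub> finsum R e I \<otimes>\<^bsub>R\<^esub> (t \<otimes>\<^bsub>R\<^esub> e j)"
      using c by (simp add: one m_assoc)
    also have "\<dots> = finsum R (\<lambda>k. e i \<otimes>\<^bsub>R\<^esub> s \<otimes>\<^bsub>R\<^esub> e k \<otimes>\<^bsub>R\<^esub> (t \<otimes>\<^bsub>R\<^esub> e j)) I"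
    proof -
      have "e i \<otimes>\<^bsub>R\<^esub> s \<otimes>\<^bsub>R\<^esub> finsum R e I = finsum R (\<lambda>k. e i \<otimes>\<^bsub>R\<^esub> s \<otimes>\<^bsub>R\<^esub> e k) I"
        by (rule finsum_rdistr) (use I e c in auto)
      moreover have "finsum R (\<lambda>k. e i \<otimes>\<^bsub>R\<^esub> s \<otimes>\<^bsub>R\<^esub> e k) I \<otimes>\<^bsub>R\<^esub> (t \<otimes>\<^bsub>R\<^esub> e j)
          = finsum R (\<lambda>k. e i \<otimes>\<^bsub>R\<^esub> s \<otimes>\<^bsub>R\<^esub> e k \<otimes>\<^bsub>R\<^esub> (t \<otimes>\<^bsub>R\<^esub> e j)) I"
        by (rule finsum_ldistr) (use I e c in auto)
      ultimately show ?thesis by simp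
    qed
    also have "\<dots> = (\<lambda>y z. \<Sum>k\<in>I. (e i \<otimes>\<^bsub>R\<^esub> s \<otimes>\<^bsub>R\<^esub> e k \<otimes>\<^bsub>R\<^esub> (t \<otimes>\<^bsub>R\<^esub> e j)) y z)"
      unfolding R_def by (rule finsum_mat_algebra[OF X]) (use e c in \<open>auto simp flip: R_def\<close>)
    finally have eq: "e i \<otimes>\<^bsub>R\<^esub> (s \<otimes>\<^bsub>R\<^esub> t) \<otimes>\<^bsub>R\<^esub> e j =
      (\<lambda>y z. \<Sum>k\<in>I. (e i \<otimes>\<^bsub>R\<^esub> s \<otimes>\<^bsub>R\<^esub> e k \<otimes>\<^bsub>R\<^esub> (t \<otimes>\<^bsub>R\<^esub> e j)) y z)" .
    have "\<exists>c. e i \<otimes>\<^bsub>R\<^esub> s \<otimes>\<^bsub>R\<^esub> e k \<otimes>\<^bsub>R\<^esub> (t \<otimes>\<^bsub>R\<^esub> e j) = c \<odot>\<^bsub>R\<^esub> u i j" if k: "k \<in> I" for k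
    proof -
      obtain a where a: "e i \<otimes>\<^bsub>R\<^esub> s \<otimes>\<^bsub>R\<^esub> e k = a \<odot>\<^bsub>R\<^esub> u i k" using D ij k by blast
      obtain b where b: "e k \<otimes>\<^bsub>R\<^esub> t \<otimes>\<^bsub>R\<^esub> e j = b \<odot>\<^bsub>R\<^esub> u k j" using D ij k by blast
      obtain d where d: "u i k \<otimes>\<^bsub>R\<^esub> u k j = d \<odot>\<^bsub>R\<^esub> u i j" using u ij k by blast
      \<comment> \<open>Idempotence doubles \<open>e k\<close>, so that both sides of the cut become
        Peirce components.\<close>
      have "e i \<otimes>\<^bsub>R\<^esub> s \<otimes>\<^bsub>R\<^esub> e k \<otimes>\<^bsub>R\<^esub> (t \<otimes>\<^bsub>R\<^esub> e j)
          = e i \<otimes>\<^bsub>R\<^esub> s \<otimes>\<^bsub>R\<^esub> (e k \<otimes>\<^bsub>R\<^esub> e k) \<otimes>\<^bsub>R\<^esub> (t \<otimes>\<^bsub>R\<^esub> e j)" by (simp add: idem k)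
      also have "\<dots> = (e i \<otimes>\<^bsub>R\<^esub> s \<otimes>\<^bsub>R\<^esub> e k) \<otimes>\<^bsub>R\<^esub> (e k \<otimes>\<^bsub>R\<^esub> t \<otimes>\<^bsub>R\<^esub> e j)"
        using c e[OF k] by (simp add: m_assoc)
      also have "\<dots> = (a * b * d) \<odot>\<^bsub>R\<^esub> u i j" by (simp add: a b d smm sma)
      finally show ?thesis by blast
    qed
    then obtain c where "\<And>k. k \<in> I \<Longrightarrow>
        e i \<otimes>\<^bsub>R\<^esub> s \<otimes>\<^bsub>R\<^esub> e k \<otimes>\<^bsub>R\<^esub> (t \<otimes>\<^bsub>R\<^esub> e j) = c k \<odot>\<^bsub>R\<^esub> u i j" by metis
    then have "e i \<otimes>\<^bsub>R\<^esub> (s \<otimes>\<^bsub>R\<^esub> t) \<otimes>\<^bsub>R\<^esub> e j = (\<Sum>k\<in>I. c k) \<odot>\<^bsub>R\<^esub> u i j"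
      by (simp add: eq) (simp add: R_def mat_algebra_simps sum_distrib_right)
    then show ?thesis by blast
  qed
  have plus: "\<exists>c. e i \<otimes>\<^bsub>R\<^esub> (s \<oplus>\<^bsub>R\<^esub> t) \<otimes>\<^bsub>R\<^esub> e j = c \<odot>\<^bsub>R\<^esub> u i j"
    if D: "s \<in> ?D" "t \<in> ?D" and ij: "i \<in> I" "j \<in> I" for s t i j
  proof -
    obtain a b where "e i \<otimes>\<^bsub>R\<^esub> s \<otimes>\<^bsub>R\<^esub> e j = a \<odot>\<^bsub>R\<^esub> u i j" "e i \<otimes>\<^bsub>R\<^esub> t \<otimes>\<^bsub>R\<^esub> e j = b \<odot>\<^bsub>R\<^esub> u i j"
      using D ij by blast
    then have "e i \<otimes>\<^bsub>R\<^esub> (s \<oplus>\<^bsub>R\<^esub> t) \<otimes>\<^bsub>R\<^esub> e j = (a + b) \<odot>\<^bsub>R\<^esub> u i j"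
      using D e ij by (simp add: l_distr r_distr add)
    then show ?thesis by blast
  qed
  have scal: "\<exists>c. e i \<otimes>\<^bsub>R\<^esub> (a \<odot>\<^bsub>R\<^esub> s) \<otimes>\<^bsub>R\<^esub> e j = c \<odot>\<^bsub>R\<^esub> u i j"
    if D: "s \<in> ?D" and ij: "i \<in> I" "j \<in> I" for s a i j
  proof -
    obtain b where "e i \<otimes>\<^bsub>R\<^esub> s \<otimes>\<^bsub>R\<^esub> e j = b \<odot>\<^bsub>R\<^esub> u i j" using D ij by blast
    then have "e i \<otimes>\<^bsub>R\<^esub> (a \<odot>\<^bsub>R\<^esub> s) \<otimes>\<^bsub>R\<^esub> e j = (a * b) \<odot>\<^bsub>R\<^esub> u i j"
      by (simp add: sml smr sma)
    then show ?thesis by blast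
  qed
  show ?thesis
    unfolding R_def is_subalgebra_mat_algebra_iff[OF X]
  proof (fold R_def, intro conjI ballI allI)
    show "(\<lambda>y z. of_bool (y \<in> X \<and> y = z)) \<in> ?D"
    proof -
      have "\<one>\<^bsub>R\<^esub> \<in> ?D" using unit e by auto
      then show ?thesis by (simp add: R_def mat_algebra_simps)
    qed
  next
    fix M N assume MN: "M \<in> ?D" "N \<in> ?D"
    have "M \<oplus>\<^bsub>R\<^esub> N \<in> ?D" using plus[OF MN] MN by auto
    then show "(\<lambda>y z. M y z + N y z) \<in> ?D" by (simp add: R_def mat_algebra_simps)
    have "M \<otimes>\<^bsub>R\<^esub> N \<in> ?D" using prod[OF MN] MN by auto
    then show "(\<lambda>y z. \<Sum>w\<in>X. M y w * N w z) \<in> ?D" by (simp add: R_def mat_algebra_simps)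
  next
    fix c M assume M: "M \<in> ?D"
    have "c \<odot>\<^bsub>R\<^esub> M \<in> ?D" using scal[OF M] M smc by auto
    then show "(\<lambda>y z. c * M y z) \<in> ?D" by (simp add: R_def mat_algebra_simps)
  qed auto
qed

section \<open>Tensor products of matrices over the points of a factorial scheme\<close>

lemma prod_of_bool:
  "finite A \<Longrightarrow> (\<Prod>a\<in>A. of_bool (P a) :: 'f::field) = of_bool (\<forall>a\<in>A. P a)"
  by (induction A rule: finite_induct) auto

lemma fact_points_eqI:
  assumes "y \<in> fact_points n U" "z \<in> fact_points n U" "\<And>h. h \<in> {1..n} \<Longrightarrow> y h = z h"
  shows "y = z"
  using assms PiE_ext unfolding fact_points_def by metis

locale factorial_scheme =
  fixes n :: nat and U :: "nat \<Rightarrow> 'u set" and x :: "nat \<Rightarrow> 'u"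
  assumes finite_U: "\<And>h. h \<in> {1..n} \<Longrightarrow> finite (U h)"
    and base_point: "x \<in> fact_points n U"
begin

abbreviation X where "X \<equiv> fact_points n U"

lemma finite_X: "finite X"
  using finite_U by (auto simp: fact_points_def intro!: finite_PiE)

lemma X_coord: "y \<in> X \<Longrightarrow> h \<in> {1..n} \<Longrightarrow> y h \<in> U h"
  by (auto simp: fact_points_def)

text \<open>The Kronecker product of the local matrices. The indicator factor supplies the zero
  entries outside \<open>X\<close> that membership in \<open>mat_algebra X\<close> demands.\<close>

definition tensor :: "(nat \<Rightarrow> 'u \<Rightarrow> 'u \<Rightarrow> 'f::field) \<Rightarrow> (nat \<Rightarrow> 'u) \<Rightarrow> (nat \<Rightarrow> 'u) \<Rightarrow> 'f" where
  "tensor M y z = of_bool (y \<in> X \<and> z \<in> X) * (\<Prod>h\<in>{1..n}. M h (y h) (z h))"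

lemma tensor_cong:
  assumes "\<And>h u v. h \<in> {1..n} \<Longrightarrow> u \<in> U h \<Longrightarrow> v \<in> U h \<Longrightarrow> M h u v = N h u v"
  shows "tensor M = tensor N"
proof (intro ext)
  fix y z
  show "tensor M y z = tensor N y z"
    using assms X_coord by (cases "y \<in> X \<and> z \<in> X") (auto simp: tensor_def intro!: prod.cong)
qed

lemma tensor_mem: "tensor M \<in> carrier (mat_algebra X)"
  by (auto simp: tensor_def mat_algebra_simps)

text \<open>The mixed-product rule: distributivity turns the sum over the product set
  \<open>X\<close> into one local sum per factor.\<close>

lemma tensor_mult:
  "(\<lambda>y z. \<Sum>w\<in>X. tensor M y w * tensor N w z)
     = tensor (\<lambda>h u v. \<Sum>w\<in>U h. M h u w * N h w v)"
proof (intro ext)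
  fix y z
  have "(\<Sum>w\<in>X. tensor M y w * tensor N w z)
      = (\<Sum>w\<in>X. of_bool (y \<in> X \<and> z \<in> X) * (\<Prod>h\<in>{1..n}. M h (y h) (w h) * N h (w h) (z h)))"
    by (rule sum.cong) (auto simp: tensor_def prod.distrib)
  also have "\<dots> = of_bool (y \<in> X \<and> z \<in> X) *
      (\<Sum>w\<in>X. \<Prod>h\<in>{1..n}. M h (y h) (w h) * N h (w h) (z h))"
    by (simp add: sum_distrib_left)
  also have "(\<Sum>w\<in>X. \<Prod>h\<in>{1..n}. M h (y h) (w h) * N h (w h) (z h))
      = (\<Prod>h\<in>{1..n}. \<Sum>w\<in>U h. M h (y h) w * N h w (z h))"
    unfolding fact_points_def
    by (rule prod_sum_PiE[symmetric]) (use finite_U in auto)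
  finally show "(\<Sum>w\<in>X. tensor M y w * tensor N w z)
     = tensor (\<lambda>h u v. \<Sum>w\<in>U h. M h u w * N h w v) y z"
    by (simp add: tensor_def)
qed

lemma tensor_sum:
  assumes "\<And>h. h \<in> {1..n} \<Longrightarrow> finite (B h)"
  shows "(\<lambda>y z. \<Sum>c\<in>Pi\<^sub>E {1..n} B. tensor (\<lambda>h. f h (c h)) y z)
     = tensor (\<lambda>h u v. \<Sum>i\<in>B h. f h i u v)"
  unfolding tensor_def sum_distrib_left[symmetric]
  by (intro ext arg_cong2[where f = "(*)"] refl prod_sum_PiE[symmetric]) (use assms in auto)

lemma tensor_one: "tensor (\<lambda>h u v. of_bool (u = v)) = (\<lambda>y z. of_bool (y \<in> X \<and> y = z))"
  by (intro ext) (auto simp: tensor_def prod_of_bool dest: fact_points_eqI)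

lemma tensor_scale: "tensor (\<lambda>h u v. c h * M h u v) = (\<lambda>y z. (\<Prod>h\<in>{1..n}. c h) * tensor M y z)"
  by (intro ext) (simp add: tensor_def prod.distrib)

lemma tensor_eq_0:
  assumes "h \<in> {1..n}" "\<And>u v. u \<in> U h \<Longrightarrow> v \<in> U h \<Longrightarrow> M h u v = 0"
  shows "tensor M = (\<lambda>y z. 0)"
proof (intro ext)
  fix y z
  show "tensor M y z = 0"
    using assms X_coord[OF _ assms(1)] by (cases "y \<in> X \<and> z \<in> X") (auto simp: tensor_def intro!: prod_zero bexI[of _ h])
qed

text \<open>The relation is a conjunction of conditions on single coordinates, so its indicator is a
  product over the coordinates.\<close>

lemma adj_mat_tensor: "adj_mat n U g = tensor (\<lambda>h u v. of_bool (u \<noteq> v \<longleftrightarrow> g h = 1))"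
  by (intro ext) (auto simp: adj_mat_def tensor_def fact_rel_def prod_of_bool)

lemma dual_idem_tensor:
  "dual_idem n U x g = tensor (\<lambda>h u v. of_bool (u = v \<and> (x h \<noteq> u \<longleftrightarrow> g h = 1)) :: 'f::field)"
proof (intro ext)
  fix y z
  show "dual_idem n U x g y z = (tensor (\<lambda>h u v. of_bool (u = v \<and> (x h \<noteq> u \<longleftrightarrow> g h = 1))) y z :: 'f)"
    using base_point fact_points_eqI[of y n U z]
    by (auto simp: dual_idem_def tensor_def fact_rel_def prod_of_bool)
qed

section \<open>Placing local matrices in the Terwilliger algebra\<close>

abbreviation T :: "((nat \<Rightarrow> 'u) \<Rightarrow> (nat \<Rightarrow> 'u) \<Rightarrow> 'f::field) set" where
  "T \<equiv> carrier (terwilliger_algebra n U x)"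

lemma generators_mem:
  "adj_mat n U ` fact_index n \<union> dual_idem n U x ` fact_index n \<subseteq> carrier (mat_algebra X)"
  using tensor_mem by (auto simp: adj_mat_tensor dual_idem_tensor)

lemma T_eq:
  "T = is_subalgebra (mat_algebra X) hull
     (adj_mat n U ` fact_index n \<union> dual_idem n U x ` fact_index n)"
  by (simp add: terwilliger_algebra_def generated_subalgebra_def)

lemma T_subalgebra: "is_subalgebra (mat_algebra X) T"
  unfolding T_eq by (rule is_subalgebra_hull[OF finite_X generators_mem])

lemma T_record: "terwilliger_algebra n U x = mat_algebra X\<lparr>carrier := T\<rparr>"
  by (simp add: terwilliger_algebra_def generated_subalgebra_def)

lemma ring_T:
  "ring (terwilliger_algebra n U x :: ('f::field, (nat \<Rightarrow> 'u) \<Rightarrow> (nat \<Rightarrow> 'u) \<Rightarrow> 'f) module)"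
proof -
  have "subring (T :: ((nat \<Rightarrow> 'u) \<Rightarrow> (nat \<Rightarrow> 'u) \<Rightarrow> 'f) set) (mat_algebra X)" 
    by (rule T_subalgebra[unfolded is_subalgebra_def, THEN conjunct1])
  then show ?thesis
    by (subst T_record) (rule ring.subring_is_ring[OF ring_mat_algebra[OF finite_X]])
qed

lemmas T_mult = is_subalgebra_mult[OF finite_X T_subalgebra]
  and T_smult = is_subalgebra_smult[OF finite_X T_subalgebra]
  and T_add = is_subalgebra_add[OF finite_X T_subalgebra]
  and T_one = is_subalgebra_one[OF finite_X T_subalgebra]
  and T_sum = is_subalgebra_sum[OF finite_X T_subalgebra]

lemma adj_mat_in_T: "g \<in> fact_index n \<Longrightarrow> adj_mat n U g \<in> T"
  and dual_idem_in_T: "g \<in> fact_index n \<Longrightarrow> dual_idem n U x g \<in> T"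
  unfolding T_eq by (rule hull_inc, simp)+

lemma T_subset:
  assumes "is_subalgebra (mat_algebra X) B"
    and "\<And>g. g \<in> fact_index n \<Longrightarrow> adj_mat n U g \<in> B"
    and "\<And>g. g \<in> fact_index n \<Longrightarrow> dual_idem n U x g \<in> B"
  shows "T \<subseteq> B"
  unfolding T_eq by (rule hull_minimal) (use assms in auto)

text \<open>The matrix \<open>M\<close> acting on the factor \<open>k\<close> and as the identity on
  all others. Every tensor is a product of such matrices, so membership in \<open>T\<close> can be
  treated one factor at a time.\<close>

definition place :: "nat \<Rightarrow> ('u \<Rightarrow> 'u \<Rightarrow> 'f::field) \<Rightarrow> (nat \<Rightarrow> 'u) \<Rightarrow> (nat \<Rightarrow> 'u) \<Rightarrow> 'f" where
  "place k M = tensor ((\<lambda>h u v. of_bool (u = v))(k := M))"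

lemma sum_of_bool_mult:
  assumes "h \<in> {1..n}" "u \<in> U h"
  shows "(\<Sum>w\<in>U h. of_bool (u = w) * f w) = (f u :: 'f::field)"
    and "(\<Sum>w\<in>U h. f w * of_bool (w = u)) = (f u :: 'f::field)"
proof -
  have "(\<Sum>w\<in>U h. of_bool (u = w) * f w) = (\<Sum>w\<in>U h. if u = w then f w else 0)"
    by (rule sum.cong) auto
  then show "(\<Sum>w\<in>U h. of_bool (u = w) * f w) = f u" using assms finite_U by simp
  have "(\<Sum>w\<in>U h. f w * of_bool (w = u)) = (\<Sum>w\<in>U h. if w = u then f w else 0)"
    by (rule sum.cong) auto
  then show "(\<Sum>w\<in>U h. f w * of_bool (w = u)) = f u" using assms finite_U by simp
qed

lemma place_mult:
  "(\<lambda>y z. \<Sum>w\<in>X. place k M y w * place k N w z) = place k (\<lambda>u v. \<Sum>w\<in>U k. M u w * N w v)"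
  unfolding place_def tensor_mult by (rule tensor_cong) (auto simp: sum_of_bool_mult)

lemma place_mult_in_T:
  "place k M \<in> T \<Longrightarrow> place k N \<in> T \<Longrightarrow> place k (\<lambda>u v. \<Sum>w\<in>U k. M u w * N w v) \<in> T"
  unfolding place_mult[symmetric] by (rule T_mult)

lemma place_lincomb:
  fixes M N :: "'u \<Rightarrow> 'u \<Rightarrow> 'f::field"
  assumes k: "k \<in> {1..n}"
  shows "place k (\<lambda>u v. a * M u v + b * N u v) = (\<lambda>y z. a * place k M y z + b * place k N y z)"
proof (intro ext)
  fix y z
  have "place k P y z = of_bool (y \<in> X \<and> z \<in> X) *
      (P (y k) (z k) * (\<Prod>h\<in>{1..n} - {k}. of_bool (y h = z h)))"
    for P :: "'u \<Rightarrow> 'u \<Rightarrow> 'f"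
  proof -
    have "(\<Prod>h\<in>{1..n} - {k}. ((\<lambda>h u v. of_bool (u = v))(k := P)) h (y h) (z h))
        = (\<Prod>h\<in>{1..n} - {k}. of_bool (y h = z h))" by (rule prod.cong) auto
    then show ?thesis unfolding place_def tensor_def using k by (subst prod.remove) auto
  qed
  then show "place k (\<lambda>u v. a * M u v + b * N u v) y z = a * place k M y z + b * place k N y z"
    by (simp add: algebra_simps)
qed

lemma place_scale:
  assumes "k \<in> {1..n}"
  shows "place k (\<lambda>u v. a * M u v) = (\<lambda>y z. a * place k M y z)"
  using place_lincomb[OF assms, of a M 0 M] by simp

lemma place_one_in_T: "place k (\<lambda>u v. of_bool (u = v)) \<in> T"
  using T_one by (simp add: place_def tensor_one fun_upd_idem)

text \<open>The diagonal of the \<open>i\<close>-th local dual idempotent. Every index other than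
  \<open>1\<close> selects the base coordinate.\<close>

definition shell :: "nat \<Rightarrow> nat \<Rightarrow> 'u \<Rightarrow> 'f::field" where
  "shell k i u = of_bool (x k \<noteq> u \<longleftrightarrow> i = 1)"

text \<open>Fix \<open>g k = i\<close> and sum the dual idempotents over all values in the other
  coordinates: there the two local idempotents add up to the identity.\<close>

lemma place_shell_in_T:
  assumes k: "k \<in> {1..n}" and i: "i < 2"
  shows "place k (\<lambda>u v. of_bool (u = v) * shell k i u) \<in> T"
proof -
  define B where "B h = (if h = k then {i} else {0, 1::nat})" for h
  have "Pi\<^sub>E {1..n} B \<subseteq> fact_index n"
    unfolding fact_index_def by (rule PiE_mono) (use i in \<open>auto simp: B_def\<close>)
  then have "(\<lambda>y z. \<Sum>g\<in>Pi\<^sub>E {1..n} B. dual_idem n U x g y z) \<in> T"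
    by (intro T_sum dual_idem_in_T) auto
  also have "(\<lambda>y z. \<Sum>g\<in>Pi\<^sub>E {1..n} B. dual_idem n U x g y z)
      = tensor (\<lambda>h u v. \<Sum>i\<in>B h. of_bool (u = v \<and> (x h \<noteq> u \<longleftrightarrow> i = 1)))"
    unfolding dual_idem_tensor by (rule tensor_sum) (auto simp: B_def)
  also have "\<dots> = place k (\<lambda>u v. of_bool (u = v) * shell k i u)"
    unfolding place_def by (rule tensor_cong) (auto simp: B_def shell_def simp del: sum_of_bool_eq)
  finally show ?thesis .
qed

text \<open>Only the coordinate \<open>k\<close> of \<open>g\<close> varies. There the identity and
  its complement add up to the all-ones matrix, while \<open>g h = 0\<close> gives the identity
  elsewhere.\<close>

lemma place_ones_in_T:
  assumes k: "k \<in> {1..n}"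
  shows "place k (\<lambda>u v. 1) \<in> T"
proof -
  define B where "B h = (if h = k then {0, 1} else {0::nat})" for h
  have "Pi\<^sub>E {1..n} B \<subseteq> fact_index n"
    unfolding fact_index_def by (rule PiE_mono) (auto simp: B_def)
  then have "(\<lambda>y z. \<Sum>g\<in>Pi\<^sub>E {1..n} B. adj_mat n U g y z) \<in> T"
    by (intro T_sum adj_mat_in_T) auto
  also have "(\<lambda>y z. \<Sum>g\<in>Pi\<^sub>E {1..n} B. adj_mat n U g y z)
      = tensor (\<lambda>h u v. \<Sum>i\<in>B h. of_bool (u \<noteq> v \<longleftrightarrow> i = 1))"
    unfolding adj_mat_tensor by (rule tensor_sum) (auto simp: B_def)
  also have "\<dots> = place k (\<lambda>u v. 1)"
    unfolding place_def by (rule tensor_cong) (auto simp: B_def simp del: sum_of_bool_eq)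
  finally show ?thesis .
qed

text \<open>The block is the all-ones matrix cut down by dual idempotents on both sides, hence a
  product of three placed matrices already in \<open>T\<close>.\<close>

lemma place_block_in_T:
  assumes k: "k \<in> {1..n}" and ij: "i < 2" "j < 2"
  shows "place k (\<lambda>u v. shell k i u * shell k j v :: 'f::field) \<in> T"
proof -
  let ?D = "\<lambda>i u v. of_bool (u = v) * shell k i u :: 'f"
  have "place k (\<lambda>u v. \<Sum>w\<in>U k. (\<Sum>w'\<in>U k. ?D i u w' * 1) * ?D j w v) \<in> T"
    by (rule place_mult_in_T[OF place_mult_in_T[OF place_shell_in_T[OF k ij(1)] place_ones_in_T[OF k]]
          place_shell_in_T[OF k ij(2)]])
  also have "place k (\<lambda>u v. \<Sum>w\<in>U k. (\<Sum>w'\<in>U k. ?D i u w' * 1) * ?D j w v)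
      = place k (\<lambda>u v. shell k i u * shell k j v)"
    unfolding place_def
  proof (rule tensor_cong)
    fix h u v assume h: "h \<in> {1..n}" and uv: "u \<in> U h" "v \<in> U h"
    show "((\<lambda>h u v. of_bool (u = v))(k := \<lambda>u v. \<Sum>w\<in>U k. (\<Sum>w'\<in>U k. ?D i u w' * 1) * ?D j w v)) h u v
        = (((\<lambda>h u v. of_bool (u = v))(k := \<lambda>u v. shell k i u * shell k j v)) h u v :: 'f)"
    proof (cases "h = k")
      case True
      have "(\<Sum>w\<in>U k. (\<Sum>w'\<in>U k. ?D i u w' * 1) * ?D j w v)
          = (\<Sum>w\<in>U k. (shell k i u * shell k j w) * of_bool (w = v) :: 'f)"
        using sum_of_bool_mult(1)[OF h uv(1), of "\<lambda>_. shell k i u :: 'f"] True by (simp add: mult_ac)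
      also have "\<dots> = shell k i u * shell k j v"
        using sum_of_bool_mult(2)[OF h uv(2), of "\<lambda>w. shell k i u * shell k j w :: 'f"] True by simp
      finally show ?thesis using True by simp
    qed simp
  qed
  finally show ?thesis .
qed

text \<open>Induction on the number of factors already filled: multiplying by
  \<open>place (Suc m) (M (Suc m))\<close> replaces the next identity factor.\<close>

lemma tensor_in_T:
  assumes M: "\<And>k. k \<in> {1..n} \<Longrightarrow> place k (M k) \<in> T"
  shows "tensor M \<in> T"
proof -
  have "m \<le> n \<Longrightarrow> tensor (\<lambda>h. if h \<le> m then M h else (\<lambda>u v. of_bool (u = v))) \<in> T" for m
  proof (induction m)
    case 0
    \<comment> \<open>Coordinates start at \<open>1\<close>, so \<open>h \<le> 0\<close> selects no
      factor.\<close>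
    have "tensor (\<lambda>h. if h \<le> 0 then M h else (\<lambda>u v. of_bool (u = v))) = tensor (\<lambda>h u v. of_bool (u = v))"
      by (rule tensor_cong) auto
    then show ?case using T_one by (simp add: tensor_one)
  next
    case (Suc m)
    let ?L = "\<lambda>h. if h \<le> m then M h else (\<lambda>u v. of_bool (u = v))"
    have "tensor (\<lambda>h. if h \<le> Suc m then M h else (\<lambda>u v. of_bool (u = v)))
        = tensor (\<lambda>h u v. \<Sum>w\<in>U h. ?L h u w * ((\<lambda>h u v. of_bool (u = v))(Suc m := M (Suc m))) h w v)"
      by (rule tensor_cong) (auto simp: sum_of_bool_mult)
    also have "\<dots> = (\<lambda>y z. \<Sum>w\<in>X. tensor ?L y w * place (Suc m) (M (Suc m)) w z)"
      unfolding place_def tensor_mult ..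
    finally show ?case using T_mult[OF Suc.IH M] Suc.prems by simp
  qed
  from this[of n] have "tensor (\<lambda>h. if h \<le> n then M h else (\<lambda>u v. of_bool (u = v))) \<in> T" by simp
  also have "tensor (\<lambda>h. if h \<le> n then M h else (\<lambda>u v. of_bool (u = v))) = tensor M"
    by (rule tensor_cong) auto
  finally show ?thesis .
qed

section \<open>Matrix units when all valencies are invertible\<close>

definition val :: "nat \<Rightarrow> 'f::field" where
  "val k = of_nat (card (U k) - 1)"

text \<open>The scalar depends on the row index only. When \<open>val k\<close> is nonzero, the
  scalar for \<open>j\<close> times the size of shell \<open>j\<close> is \<open>1\<close>, which is
  what the matrix unit relations require.\<close>

definition block :: "nat \<Rightarrow> nat \<Rightarrow> nat \<Rightarrow> 'u \<Rightarrow> 'u \<Rightarrow> 'f::field" where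
  "block k i j u v = (if i = 0 then 1 else inverse (val k)) * (shell k i u * shell k j v)"

text \<open>
  On the factor \<open>k\<close>, the indices \<open>0\<close> and \<open>1\<close> carry the matrix units of a two-by-two
  matrix block, and \<open>2\<close> the complementary central idempotent, which vanishes iff \<open>U k\<close>
  has two elements.
\<close>

definition local_unit :: "nat \<Rightarrow> nat \<Rightarrow> nat \<Rightarrow> 'u \<Rightarrow> 'u \<Rightarrow> 'f::field" where
  "local_unit k i j u v =
     (if i < 2 \<and> j < 2 then block k i j u v
      else if i = 2 \<and> j = 2 then of_bool (u = v) - block k 0 0 u v - block k 1 1 u v
      else 0)"

lemma less_two: "(i::nat) < 2 \<longleftrightarrow> i = 0 \<or> i = 1" by auto
lemma less_three: "(i::nat) < 3 \<longleftrightarrow> i = 0 \<or> i = 1 \<or> i = 2" by auto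

lemma place_local_unit_in_T:
  assumes k: "k \<in> {1..n}"
  shows "place k (local_unit k i j :: _ \<Rightarrow> _ \<Rightarrow> 'f::field) \<in> T"
proof -
  have block: "place k (block k i j :: _ \<Rightarrow> _ \<Rightarrow> 'f) \<in> T" if "i < 2" "j < 2" for i j
  proof -
    have "place k (block k i j :: _ \<Rightarrow> _ \<Rightarrow> 'f) = (\<lambda>y z. (if i = 0 then 1 else inverse (val k)) *
        place k (\<lambda>u v. shell k i u * shell k j v) y z)"
      by (subst place_scale[OF k, symmetric]) (simp add: block_def[abs_def])
    then show ?thesis by (simp only: T_smult[OF place_block_in_T[OF k that]])
  qed
  consider "i < 2 \<and> j < 2" | "i = 2 \<and> j = 2" | "\<not> (i < 2 \<and> j < 2)" "\<not> (i = 2 \<and> j = 2)" by blast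
  then show ?thesis
  proof cases
    case 1
    then show ?thesis using block[of i j] by (simp add: local_unit_def[abs_def])
  next
    case 2
    \<comment> \<open>Written as two nested linear combinations so that \<open>place_lincomb\<close>
      applies twice.\<close>
    have "place k (local_unit k i j) = place k (\<lambda>u v. 1 * (1 * of_bool (u = v) + (-1) * block k 0 0 u v)
        + (-1) * block k 1 1 u v :: 'f)"
      using 2 by (simp add: local_unit_def[abs_def])
    also have "\<dots> = (\<lambda>y z. 1 * (1 * place k (\<lambda>u v. of_bool (u = v)) y z + (-1) * place k (block k 0 0) y z)
        + (-1) * place k (block k 1 1) y z)"
      unfolding place_lincomb[OF k] ..
    also have "\<dots> \<in> T"
      by (intro T_add T_smult place_one_in_T block) auto
    finally show ?thesis .
  next
    case 3
    then have "local_unit k i j = (\<lambda>u v. 0 * of_bool (u = v) :: 'f)"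
      by (intro ext) (auto simp: local_unit_def)
    then have "place k (local_unit k i j) = place k (\<lambda>u v. 0 * of_bool (u = v) :: 'f)"
      by (rule arg_cong)
    also have "\<dots> \<in> T" unfolding place_scale[OF k] by (intro T_smult place_one_in_T)
    finally show ?thesis .
  qed
qed

text \<open>The two shells are disjoint, so the sum either vanishes or counts one shell: the base
  point alone, or all the other points of the factor.\<close>

lemma sum_shell:
  assumes k: "k \<in> {1..n}" and ij: "i < 2" "j < 2"
  shows "(\<Sum>w\<in>U k. shell k i w * shell k j w) = (if i = j then if i = 0 then 1 else val k else 0 :: 'f::field)"
proof -
  have xk: "x k \<in> U k" using X_coord[OF base_point k] .
  then have card: "1 \<le> card (U k)" using finite_U[OF k] by (simp add: Suc_le_eq card_gt_0_iff) blast
  have s0: "(\<Sum>w\<in>U k. of_bool (x k = w)) = (1 :: 'f)"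
    using sum_of_bool_mult(1)[OF k xk, of "\<lambda>_. 1"] by simp
  have tot: "(\<Sum>w\<in>U k. shell k i w) = (if i = 0 then 1 else val k :: 'f)"
  proof (cases "i = 0")
    case True
    then show ?thesis using s0 by (simp add: shell_def del: sum_of_bool_eq)
  next
    case False
    then have "(\<Sum>w\<in>U k. shell k i w) = (\<Sum>w\<in>U k. 1 - of_bool (x k = w) :: 'f)"
      using ij by (intro sum.cong) (auto simp: shell_def)
    also have "\<dots> = of_nat (card (U k)) - 1" by (simp only: sum_subtractf s0) simp
    finally show ?thesis using False card by (simp add: val_def of_nat_diff)
  qed
  have mul: "shell k i w * shell k j w = (if i = j then shell k i w else 0 :: 'f)" for w
    using ij by (auto simp: less_two shell_def)
  show ?thesis unfolding mul using tot by (cases "i = j") (simp_all only: simp_thms if_True if_False sum.neutral_const)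
qed

section \<open>Multiplication of local units when the local valency is invertible\<close>

context
  fixes k :: nat
  assumes k: "k \<in> {1..n}" and val: "(val k :: 'f::field) \<noteq> 0"
begin

lemma block_mult:
  assumes "i < 2" "j < 2" "p < 2" "q < 2"
  shows "(\<Sum>w\<in>U k. block k i j u w * block k p q w v) = (if j = p then block k i q u v else 0 :: 'f)"
proof -
  have "(\<Sum>w\<in>U k. block k i j u w * block k p q w v) = (if i = 0 then 1 else inverse (val k)) *
      (if p = 0 then 1 else inverse (val k)) * shell k i u * shell k q v * (\<Sum>w\<in>U k. shell k j w * shell k p w :: 'f)"
    by (simp add: block_def sum_distrib_left mult_ac)
  then show ?thesis using val by (simp add: sum_shell[OF k assms(2,3)] block_def)
qed

text \<open>A local unit is zero when exactly one of its indices is \<open>2\<close>; the two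
  equivalences exclude this for both factors. Otherwise the rule is that of matrix units, and the
  index combinations are checked one by one.\<close>

lemma local_unit_mult:
  assumes "i < 3" "j < 3" "p < 3" "q < 3" and uv: "u \<in> U k" "v \<in> U k"
  shows "(\<Sum>w\<in>U k. local_unit k i j u w * local_unit k p q w v)
     = (if j = p \<and> (i = 2 \<longleftrightarrow> j = 2) \<and> (p = 2 \<longleftrightarrow> q = 2) then local_unit k i q u v else 0 :: 'f)"
proof -
  note sums = sum_of_bool_mult[OF k uv(1)] sum_of_bool_mult[OF k uv(2)]
  show ?thesis
    using assms(1-4) unfolding less_three local_unit_def
    by (elim disjE; simp add: block_mult sums left_diff_distrib right_diff_distrib sum_subtractf)
qed

text \<open>Multiplying an expansion by the diagonal units \<open>i\<close> and \<open>j\<close> on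
  the two sides kills every term except the one at \<open>(i, j)\<close>.\<close>

lemma local_unit_corner:
  fixes M :: "'u \<Rightarrow> 'u \<Rightarrow> 'f"
  assumes ij: "i < 3" "j < 3" and uv: "u \<in> U k" "v \<in> U k"
    and M: "\<And>u v. u \<in> U k \<Longrightarrow> v \<in> U k \<Longrightarrow> M u v = (\<Sum>p<3. \<Sum>q<3. c p q * local_unit k p q u v)"
  shows "(\<Sum>w\<in>U k. (\<Sum>w'\<in>U k. local_unit k i i u w' * M w' w) * local_unit k j j w v) = c i j * local_unit k i j u v"
proof -
  have left: "(\<Sum>w'\<in>U k. local_unit k i i u w' * local_unit k p q w' w)
      = (if p = i then local_unit k i q u w else 0 :: 'f)" if "p < 3" "q < 3" "w \<in> U k" for p q w
    using local_unit_mult[of i i p q u w] that ij uv by (auto simp: local_unit_def)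
  have right: "(\<Sum>w\<in>U k. local_unit k i q u w * local_unit k j j w v)
      = (if q = j then local_unit k i j u v else 0 :: 'f)" if "q < 3" for q
    using local_unit_mult[of i q j j u v] that ij uv by (auto simp: local_unit_def)
  have "(\<Sum>w'\<in>U k. local_unit k i i u w' * M w' w) = (\<Sum>q<3. c i q * local_unit k i q u w)"
    if w: "w \<in> U k" for w
  proof -
    have "(\<Sum>w'\<in>U k. local_unit k i i u w' * M w' w)
        = (\<Sum>w'\<in>U k. \<Sum>p<3. \<Sum>q<3. c p q * (local_unit k i i u w' * local_unit k p q w' w))"
      by (rule sum.cong) (auto simp: M w sum_distrib_left mult_ac)
    also have "\<dots> = (\<Sum>p<3. \<Sum>q<3. c p q * (\<Sum>w'\<in>U k. local_unit k i i u w' * local_unit k p q w' w))"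
      unfolding sum_distrib_left by (subst sum.swap, rule sum.cong[OF refl], rule sum.swap)
    also have "\<dots> = (\<Sum>p<3. if p = i then \<Sum>q<3. c i q * local_unit k i q u w else 0)"
      by (intro sum.cong refl) (auto simp: left w intro!: sum.neutral sum.cong)
    also have "\<dots> = (\<Sum>q<3. c i q * local_unit k i q u w)" using ij by (simp add: sum.delta)
    finally show ?thesis .
  qed
  then have "(\<Sum>w\<in>U k. (\<Sum>w'\<in>U k. local_unit k i i u w' * M w' w) * local_unit k j j w v)
      = (\<Sum>w\<in>U k. \<Sum>q<3. c i q * (local_unit k i q u w * local_unit k j j w v))"
    by (intro sum.cong) (auto simp: sum_distrib_right mult.assoc)
  also have "\<dots> = (\<Sum>q<3. c i q * (\<Sum>w\<in>U k. local_unit k i q u w * local_unit k j j w v))"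
    unfolding sum_distrib_left by (rule sum.swap)
  also have "\<dots> = (\<Sum>q<3. if q = j then c i j * local_unit k i j u v else 0)"
    by (intro sum.cong refl) (auto simp: right)
  also have "\<dots> = c i j * local_unit k i j u v" using ij by (simp add: sum.delta)
  finally show ?thesis .
qed

lemma local_generators_expand:
  fixes M :: "'u \<Rightarrow> 'u \<Rightarrow> 'f"
  assumes M: "M = (\<lambda>u v. of_bool (u \<noteq> v \<longleftrightarrow> (g::nat) = 1)) \<or>
              M = (\<lambda>u v. of_bool (u = v \<and> (x k \<noteq> u \<longleftrightarrow> g = 1)))"
  shows "\<exists>c. \<forall>u\<in>U k. \<forall>v\<in>U k. M u v = (\<Sum>p<3. \<Sum>q<3. c p q * local_unit k p q u v)"
proof -
  have three: "{..<3} = {0, 1, 2::nat}" by auto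
  define one where "one p q = (of_bool (p = q) :: 'f)" for p q :: nat
  \<comment> \<open>Coefficients of the all-ones matrix, the sum of the four unnormalised blocks:
    \<open>val k\<close> cancels the inverse in row \<open>1\<close>.\<close>
  define ones where "ones p q = (if p < 2 \<and> q < 2 then if p = 0 then 1 else val k else 0 :: 'f)" for p q :: nat
  \<comment> \<open>The base point idempotent is the unit at \<open>(0, 0)\<close>; its complement
    is the sum of the diagonal units \<open>1\<close> and \<open>2\<close>.\<close>
  define sh where "sh p q = (if g = 1 then of_bool (p = q \<and> p \<noteq> 0) else of_bool (p = 0 \<and> q = 0) :: 'f)" for p q :: nat
  have "of_bool (u = v) = (\<Sum>p<3. \<Sum>q<3. one p q * local_unit k p q u v)" for u v
    by (simp add: three one_def local_unit_def)
  moreover have "1 = (\<Sum>p<3. \<Sum>q<3. ones p q * local_unit k p q u v)" for u v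
    using val by (auto simp: three ones_def local_unit_def block_def shell_def)
  ultimately have A: "of_bool (u \<noteq> v) = (\<Sum>p<3. \<Sum>q<3. (ones p q - one p q) * local_unit k p q u v)"
    "of_bool (u = v) = (\<Sum>p<3. \<Sum>q<3. one p q * local_unit k p q u v)" for u v
    by (simp_all add: left_diff_distrib sum_subtractf of_bool_not_iff)
  have B: "of_bool (u = v \<and> (x k \<noteq> u \<longleftrightarrow> g = 1)) = (\<Sum>p<3. \<Sum>q<3. sh p q * local_unit k p q u v)" for u v
    by (auto simp: three sh_def local_unit_def block_def shell_def)
  from M show ?thesis
  proof
    assume M: "M = (\<lambda>u v. of_bool (u \<noteq> v \<longleftrightarrow> g = 1))"
    show ?thesis
    proof (cases "g = 1")
      case True
      then show ?thesis using A(1) M by (intro exI[of _ "\<lambda>p q. ones p q - one p q"] ballI) simp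
    next
      case False
      then show ?thesis using A(2) M by (intro exI[of _ one] ballI) simp
    qed
  next
    assume "M = (\<lambda>u v. of_bool (u = v \<and> (x k \<noteq> u \<longleftrightarrow> g = 1)))"
    then show ?thesis using B by (intro exI[of _ sh] ballI) simp
  qed
qed

end

section \<open>Global matrix units as tensor products of local ones\<close>

definition unit_index :: "(nat \<Rightarrow> nat) set" where
  "unit_index = (\<Pi>\<^sub>E h\<in>{1..n}. {..<3})"

definition mat_unit :: "(nat \<Rightarrow> nat) \<Rightarrow> (nat \<Rightarrow> nat) \<Rightarrow> (nat \<Rightarrow> 'u) \<Rightarrow> (nat \<Rightarrow> 'u) \<Rightarrow> 'f::field" where
  "mat_unit c d = tensor (\<lambda>h. local_unit h (c h) (d h))"

lemma unit_index_less: "c \<in> unit_index \<Longrightarrow> h \<in> {1..n} \<Longrightarrow> c h < 3"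
  by (auto simp: unit_index_def)

lemma unit_index_eqI:
  "b \<in> unit_index \<Longrightarrow> c \<in> unit_index \<Longrightarrow> (\<And>h. h \<in> {1..n} \<Longrightarrow> b h = c h) \<Longrightarrow> b = c"
  unfolding unit_index_def by (rule PiE_ext)

lemma finite_unit_index: "finite unit_index"
  by (auto simp: unit_index_def intro!: finite_PiE)

lemma mat_unit_in_T: "mat_unit c d \<in> T"
  unfolding mat_unit_def by (intro tensor_in_T place_local_unit_in_T)

lemma mat_unit_mem: "mat_unit c d \<in> carrier (mat_algebra X)"
  unfolding mat_unit_def by (rule tensor_mem)

text \<open>In each factor the three diagonal units sum to the identity by the choice of the third,
  and the tensor product of these sums expands over \<open>unit_index\<close>.\<close>

lemma sum_mat_unit:
  "(\<lambda>y z. \<Sum>c\<in>unit_index. mat_unit c c y z) = (\<lambda>y z. of_bool (y \<in> X \<and> y = z) :: 'f::field)"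
proof -
  have "(\<lambda>y z. \<Sum>c\<in>unit_index. mat_unit c c y z :: 'f) = tensor (\<lambda>h u v. \<Sum>i<3. local_unit h i i u v)"
    unfolding mat_unit_def unit_index_def
    by (rule tensor_sum[of "\<lambda>_. {..<3}" "\<lambda>h i. local_unit h i i"]) auto
  also have "\<dots> = tensor (\<lambda>h u v. of_bool (u = v))"
    by (rule tensor_cong) (simp add: local_unit_def numeral_3_eq_3)
  finally show ?thesis by (simp add: tensor_one)
qed

text \<open>The local rule is applied in every factor; a single factor where it gives zero kills the
  whole tensor.\<close>

lemma mat_unit_mult:
  assumes val: "\<forall>k\<in>{1..n}. (val k :: 'f::field) \<noteq> 0"
    and ix: "a \<in> unit_index" "b \<in> unit_index" "c \<in> unit_index" "d \<in> unit_index"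
  shows "mat_unit a b \<otimes>\<^bsub>mat_algebra X\<^esub> mat_unit c d =
    (if b = c \<and> (\<forall>h\<in>{1..n}. (a h = 2 \<longleftrightarrow> b h = 2) \<and> (c h = 2 \<longleftrightarrow> d h = 2))
     then mat_unit a d else (\<lambda>y z. 0 :: 'f))"
proof -
  let ?P = "\<lambda>h. b h = c h \<and> (a h = 2 \<longleftrightarrow> b h = 2) \<and> (c h = 2 \<longleftrightarrow> d h = 2)"
  have "mat_unit a b \<otimes>\<^bsub>mat_algebra X\<^esub> mat_unit c d = tensor (\<lambda>h u v. \<Sum>w\<in>U h.
      local_unit h (a h) (b h) u w * local_unit h (c h) (d h) w v :: 'f)"
    unfolding mat_unit_def mat_algebra_simps tensor_mult ..
  also have "\<dots> = tensor (\<lambda>h u v. if ?P h then local_unit h (a h) (d h) u v else 0)"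
    by (rule tensor_cong) (use ix val in \<open>simp add: local_unit_mult unit_index_less\<close>)
  also have "\<dots> = (if \<forall>h\<in>{1..n}. ?P h then mat_unit a d else (\<lambda>y z. 0))"
  proof (cases "\<forall>h\<in>{1..n}. ?P h")
    case True
    then have "tensor (\<lambda>h u v. if ?P h then local_unit h (a h) (d h) u v else 0) = (mat_unit a d :: _ \<Rightarrow> _ \<Rightarrow> 'f)"
      unfolding mat_unit_def by (intro tensor_cong) simp
    then show ?thesis by (simp only: if_P[OF True])
  next
    case False
    then obtain h where "h \<in> {1..n}" "\<not> ?P h" by blast
    then have "tensor (\<lambda>h u v. if ?P h then local_unit h (a h) (d h) u v else 0 :: 'f) = (\<lambda>y z. 0)"
      by (intro tensor_eq_0[of h]) auto
    then show ?thesis by (simp only: if_not_P[OF False])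
  qed
  also have "(\<forall>h\<in>{1..n}. ?P h) \<longleftrightarrow> b = c \<and> (\<forall>h\<in>{1..n}. (a h = 2 \<longleftrightarrow> b h = 2) \<and> (c h = 2 \<longleftrightarrow> d h = 2))"
  proof
    assume all: "\<forall>h\<in>{1..n}. ?P h"
    then have "b = c" by (intro unit_index_eqI[OF ix(2,3)]) blast
    then show "b = c \<and> (\<forall>h\<in>{1..n}. (a h = 2 \<longleftrightarrow> b h = 2) \<and> (c h = 2 \<longleftrightarrow> d h = 2))"
      using all by simp
  qed simp
  finally show ?thesis .
qed

text \<open>Each factor contributes one coefficient of the local expansion, and their product over
  the factors is the scalar \<open>c\<close>. Both kinds of generators are covered.\<close>

lemma tensor_corner:
  assumes val: "\<forall>k\<in>{1..n}. (val k :: 'f::field) \<noteq> 0"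
    and ix: "a \<in> unit_index" "b \<in> unit_index"
    and M: "\<And>h. h \<in> {1..n} \<Longrightarrow> M h = (\<lambda>u v. of_bool (u \<noteq> v \<longleftrightarrow> (g h::nat) = 1)) \<or>
              M h = (\<lambda>u v. of_bool (u = v \<and> (x h \<noteq> u \<longleftrightarrow> g h = 1)))"
  shows "\<exists>c. mat_unit a a \<otimes>\<^bsub>mat_algebra X\<^esub> tensor M \<otimes>\<^bsub>mat_algebra X\<^esub> mat_unit b b
     = (c::'f) \<odot>\<^bsub>mat_algebra X\<^esub> mat_unit a b"
proof -
  have "\<exists>c. \<forall>u\<in>U h. \<forall>v\<in>U h. M h u v = (\<Sum>p<3. \<Sum>q<3. c p q * local_unit h p q u v)"
    if h: "h \<in> {1..n}" for h
    by (rule local_generators_expand[OF h bspec[OF val h] M[OF h]])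
  then have "\<exists>C. \<forall>h\<in>{1..n}. \<forall>u\<in>U h. \<forall>v\<in>U h. M h u v = (\<Sum>p<3. \<Sum>q<3. C h p q * local_unit h p q u v)"
    by (intro bchoice ballI)
  then obtain C where C: "\<And>h u v. h \<in> {1..n} \<Longrightarrow> u \<in> U h \<Longrightarrow> v \<in> U h \<Longrightarrow>
      M h u v = (\<Sum>p<3. \<Sum>q<3. C h p q * local_unit h p q u v)" by (elim exE) (simp only: Ball_def)
  have "mat_unit a a \<otimes>\<^bsub>mat_algebra X\<^esub> tensor M \<otimes>\<^bsub>mat_algebra X\<^esub> mat_unit b b
      = tensor (\<lambda>h u v. \<Sum>w\<in>U h. (\<Sum>w'\<in>U h. local_unit h (a h) (a h) u w' * M h w' w)
          * local_unit h (b h) (b h) w v)"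
  proof -
    have "mat_unit a a \<otimes>\<^bsub>mat_algebra X\<^esub> tensor M
        = tensor (\<lambda>h u v. \<Sum>w\<in>U h. local_unit h (a h) (a h) u w * M h w v)"
      unfolding mat_unit_def mat_algebra_simps tensor_mult ..
    then show ?thesis unfolding mat_unit_def by (simp add: mat_algebra_simps tensor_mult)
  qed
  also have "\<dots> = tensor (\<lambda>h u v. C h (a h) (b h) * local_unit h (a h) (b h) u v)"
  proof (rule tensor_cong)
    fix h u v assume h: "h \<in> {1..n}" and uv: "u \<in> U h" "v \<in> U h"
    show "(\<Sum>w\<in>U h. (\<Sum>w'\<in>U h. local_unit h (a h) (a h) u w' * M h w' w) * local_unit h (b h) (b h) w v)
        = C h (a h) (b h) * local_unit h (a h) (b h) u v"
      by (rule local_unit_corner[OF h bspec[OF val h] unit_index_less[OF ix(1) h] unit_index_less[OF ix(2) h] uv])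
         (use C h in auto)
  qed
  also have "\<dots> = (\<Prod>h\<in>{1..n}. C h (a h) (b h)) \<odot>\<^bsub>mat_algebra X\<^esub> mat_unit a b"
    by (simp add: tensor_scale mat_unit_def mat_algebra_simps)
  finally show ?thesis by blast
qed

text \<open>By \<open>is_subalgebra_peirce_lines\<close>, every Peirce component of an element of
  \<open>T\<close> is a multiple of one matrix unit. A nonzero multiple of the unit at
  \<open>(i, j)\<close> is taken to the idempotent of \<open>j\<close> by a multiple of the unit at
  \<open>(j, i)\<close>.\<close>

lemma semisimple_if_valencies_nonzero:
  assumes val: "\<forall>k\<in>{1..n}. (val k :: 'f::field) \<noteq> 0"
  shows "semisimple (terwilliger_algebra n U x :: ('f, (nat \<Rightarrow> 'u) \<Rightarrow> (nat \<Rightarrow> 'u) \<Rightarrow> 'f) module)"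
proof -
  let ?R = "mat_algebra X :: ('f, (nat \<Rightarrow> 'u) \<Rightarrow> (nat \<Rightarrow> 'u) \<Rightarrow> 'f) module"
  let ?u = "mat_unit :: _ \<Rightarrow> _ \<Rightarrow> _ \<Rightarrow> _ \<Rightarrow> 'f"
  let ?D = "{t \<in> carrier ?R. \<forall>i\<in>unit_index. \<forall>j\<in>unit_index.
     \<exists>c. ?u i i \<otimes>\<^bsub>?R\<^esub> t \<otimes>\<^bsub>?R\<^esub> ?u j j = c \<odot>\<^bsub>?R\<^esub> ?u i j}"
  note mult = mat_unit_mult[OF val]
  have zero: "(\<lambda>y z. 0) = 0 \<odot>\<^bsub>?R\<^esub> ?u i j" "?u i j = 1 \<odot>\<^bsub>?R\<^esub> ?u i j" for i j
    by (simp_all add: mat_algebra_simps)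
  have D: "is_subalgebra ?R ?D"
  proof (rule is_subalgebra_peirce_lines[OF finite_X finite_unit_index mat_unit_mem])
    show "finsum ?R (\<lambda>i. ?u i i) unit_index = \<one>\<^bsub>?R\<^esub>"
      by (subst finsum_mat_algebra[OF finite_X mat_unit_mem], subst sum_mat_unit)
         (simp add: mat_algebra_simps)
    show "\<exists>c. ?u i i \<otimes>\<^bsub>?R\<^esub> ?u j j = c \<odot>\<^bsub>?R\<^esub> ?u i j" if "i \<in> unit_index" "j \<in> unit_index" for i j
      unfolding mult[OF that(1) that(1) that(2) that(2)] using zero by metis
    show "\<exists>c. ?u i j \<otimes>\<^bsub>?R\<^esub> ?u j k = c \<odot>\<^bsub>?R\<^esub> ?u i k"
      if "i \<in> unit_index" "j \<in> unit_index" "k \<in> unit_index" for i j k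
      unfolding mult[OF that(1) that(2) that(2) that(3)] using zero by metis
  qed (simp add: mult)
  have "T \<subseteq> ?D"
  proof (rule T_subset[OF D])
    show "adj_mat n U g \<in> ?D" for g
      unfolding adj_mat_tensor
      by (intro CollectI conjI ballI tensor_mem tensor_corner[OF val, where g = g]) auto
    show "dual_idem n U x g \<in> ?D" for g
      unfolding dual_idem_tensor
      by (intro CollectI conjI ballI tensor_mem tensor_corner[OF val, where g = g]) auto
  qed
  interpret ring "terwilliger_algebra n U x :: ('f, (nat \<Rightarrow> 'u) \<Rightarrow> (nat \<Rightarrow> 'u) \<Rightarrow> 'f) module"
    by (rule ring_T)
  let ?T = "terwilliger_algebra n U x :: ('f, (nat \<Rightarrow> 'u) \<Rightarrow> (nat \<Rightarrow> 'u) \<Rightarrow> 'f) module"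
  have ops: "mult ?T = mult ?R" "one ?T = one ?R" "zero ?T = (\<lambda>y z. 0)"
    by (simp_all add: terwilliger_algebra_def generated_subalgebra_def mat_algebra_simps)
  show ?thesis
  proof (rule semisimple_of_orthogonal_idempotents[OF finite_unit_index mat_unit_in_T])
    show "?u i i \<otimes>\<^bsub>?T\<^esub> ?u j j = (if i = j then ?u i i else \<zero>\<^bsub>?T\<^esub>)"
      if "i \<in> unit_index" "j \<in> unit_index" for i j
      unfolding ops mult[OF that(1) that(1) that(2) that(2)] by auto
    show "finsum ?T (\<lambda>i. ?u i i) unit_index = \<one>\<^bsub>?T\<^esub>"
      unfolding ops
      by (subst T_record, subst finsum_subalgebra[OF finite_X T_subalgebra mat_unit_in_T],
          subst sum_mat_unit) (simp add: mat_algebra_simps)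
    fix i j t assume ij: "i \<in> unit_index" "j \<in> unit_index" and t: "t \<in> carrier ?T"
      and nz: "?u i i \<otimes>\<^bsub>?T\<^esub> t \<otimes>\<^bsub>?T\<^esub> ?u j j \<noteq> \<zero>\<^bsub>?T\<^esub>"
    obtain c where c: "?u i i \<otimes>\<^bsub>?R\<^esub> t \<otimes>\<^bsub>?R\<^esub> ?u j j = c \<odot>\<^bsub>?R\<^esub> ?u i j"
      using \<open>T \<subseteq> ?D\<close> t ij by blast
    have "c \<noteq> 0" "?u i j \<noteq> (\<lambda>y z. 0)"
      using nz unfolding ops c by (auto simp: mat_algebra_simps)
    \<comment> \<open>Otherwise the local unit of the factor \<open>h\<close> is zero, and the
      tensor with it. This is the index condition under which the units at \<open>(j, i)\<close> and
      \<open>(i, j)\<close> multiply to the idempotent of \<open>j\<close>.\<close>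
    have "(i h = 2) = (j h = 2)" if h: "h \<in> {1..n}" for h
    proof (rule ccontr)
      assume "(i h = 2) \<noteq> (j h = 2)"
      then have "?u i j = (\<lambda>y z. 0)"
        unfolding mat_unit_def by (intro tensor_eq_0[OF h]) (auto simp: local_unit_def)
      with \<open>?u i j \<noteq> (\<lambda>y z. 0)\<close> show False by contradiction
    qed
    then have "?u j i \<otimes>\<^bsub>?R\<^esub> ?u i j = ?u j j" using mult[OF ij(2,1) ij] by auto
    then have "(inverse c \<odot>\<^bsub>?R\<^esub> ?u j i) \<otimes>\<^bsub>?R\<^esub> (c \<odot>\<^bsub>?R\<^esub> ?u i j) = ?u j j"
      using \<open>c \<noteq> 0\<close> by (simp add: mat_algebra_simps field_simps)
    moreover have "inverse c \<odot>\<^bsub>?R\<^esub> ?u j i \<in> carrier ?T"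
      unfolding mat_algebra_simps by (rule T_smult[OF mat_unit_in_T])
    ultimately show "\<exists>s\<in>carrier ?T. s \<otimes>\<^bsub>?T\<^esub> (?u i i \<otimes>\<^bsub>?T\<^esub> t \<otimes>\<^bsub>?T\<^esub> ?u j j) = ?u j j"
      unfolding ops c by blast
  qed
qed

section \<open>A nilpotent element when some valency vanishes\<close>

context
  fixes k :: nat
  assumes k: "k \<in> {1..n}"
begin

section \<open>Transpositions of two points in one factor\<close>

definition swap :: "'u \<Rightarrow> 'u \<Rightarrow> (nat \<Rightarrow> 'u) \<Rightarrow> nat \<Rightarrow> 'u" where
  "swap u v y = y(k := if y k = u then v else if y k = v then u else y k)"

lemma swap_X:
  assumes "u \<in> U k" "v \<in> U k" "y \<in> X"
  shows "swap u v y \<in> X"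
  using assms k by (auto simp: swap_def fact_points_def PiE_iff extensional_def)

lemma swap_swap: "swap u v (swap u v y) = y"
  by (auto simp: swap_def fun_eq_iff)

lemma sum_swap:
  assumes "u \<in> U k" "v \<in> U k"
  shows "(\<Sum>w\<in>X. f (swap u v w)) = (\<Sum>w\<in>X. f w)"
  by (rule sum.reindex_bij_witness[of _ "swap u v" "swap u v"])
     (use assms in \<open>auto simp: swap_swap swap_X\<close>)

text \<open>The transposition preserves coordinatewise equality and fixes the base point, so all
  generators are invariant. Invariant matrices form a subalgebra; for products, the summation
  variable is reindexed by the transposition.\<close>

lemma T_swap_invariant:
  assumes u: "u \<in> U k" "u \<noteq> x k" and v: "v \<in> U k" "v \<noteq> x k"
    and M: "M \<in> T" and yz: "y \<in> X" "z \<in> X"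
  shows "M (swap u v y) (swap u v z) = (M y z :: 'f::field)"
proof -
  let ?B = "{M \<in> carrier (mat_algebra X). \<forall>y\<in>X. \<forall>z\<in>X. M (swap u v y) (swap u v z) = (M y z :: 'f)}"
  have inj: "swap u v y = swap u v z \<longleftrightarrow> y = z" for y z by (metis swap_swap)
  have "is_subalgebra (mat_algebra X) ?B"
  proof (rule is_subalgebra_mat_algebra_iff[OF finite_X, THEN iffD2], intro conjI ballI allI)
    show "(\<lambda>y z. of_bool (y \<in> X \<and> y = z)) \<in> ?B"
      using swap_X[OF u(1) v(1)] by (auto simp: mat_algebra_simps inj)
    fix M N assume MN: "M \<in> ?B" "N \<in> ?B"
    then show "(\<lambda>y z. M y z + N y z) \<in> ?B" by (auto simp: mat_algebra_simps)
    have "(\<Sum>w\<in>X. M (swap u v y) w * N w (swap u v z)) = (\<Sum>w\<in>X. M y w * N w z)"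
      if "y \<in> X" "z \<in> X" for y z
    proof -
      have "(\<Sum>w\<in>X. M (swap u v y) w * N w (swap u v z))
          = (\<Sum>w\<in>X. M (swap u v y) (swap u v w) * N (swap u v w) (swap u v z))"
        by (rule sum_swap[OF u(1) v(1), symmetric])
      also have "\<dots> = (\<Sum>w\<in>X. M y w * N w z)"
        by (rule sum.cong) (use MN that in auto)
      finally show ?thesis .
    qed
    then show "(\<lambda>y z. \<Sum>w\<in>X. M y w * N w z) \<in> ?B" using MN by (auto simp: mat_algebra_simps)
  qed (auto simp: mat_algebra_simps)
  moreover have coord: "(swap u v y a = swap u v z a) = (y a = z a)" "(x a = swap u v y a) = (x a = y a)" for y z a
    using u v by (auto simp: swap_def)
  have "adj_mat n U g \<in> ?B" "dual_idem n U x g \<in> ?B" for g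
    using generators_mem swap_X[OF u(1) v(1)]
    by (auto simp: mat_algebra_simps adj_mat_def dual_idem_def fact_rel_def coord inj)
  ultimately have "T \<subseteq> ?B" by (intro T_subset)
  then show ?thesis using M yz by blast
qed

text \<open>Where it is not trivially zero, an entry of the product \<open>a\<close>,
  \<open>t\<close>, \<open>a\<close> is a sum of entries of \<open>t\<close> over
  \<open>W \<times> W\<close>, with \<open>W\<close> the non-base points of the factor. Invariance
  under transpositions makes it a multiple of \<open>card W\<close>, which is zero in the
  field.\<close>

lemma not_semisimple_if_valency_zero:
  assumes val: "(val k :: 'f::field) = 0" and card: "2 \<le> card (U k)"
  shows "\<not> semisimple (terwilliger_algebra n U x :: ('f, (nat \<Rightarrow> 'u) \<Rightarrow> (nat \<Rightarrow> 'u) \<Rightarrow> 'f) module)"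
proof
  let ?T = "terwilliger_algebra n U x :: ('f, (nat \<Rightarrow> 'u) \<Rightarrow> (nat \<Rightarrow> 'u) \<Rightarrow> 'f) module"
  assume ss: "semisimple ?T"
  interpret ring ?T by (rule ring_T)
  define W where "W = U k - {x k}"
  have xk: "x k \<in> U k" using X_coord[OF base_point k] .
  have W: "finite W" "of_nat (card W) = (0 :: 'f)" "W \<subseteq> U k"
    using finite_U[OF k] xk val by (auto simp: W_def val_def)
  \<comment> \<open>At least two points in the factor leave a non-base point \<open>b\<close>. It
    serves as the reference point for the constant inner sum and as witness that \<open>a\<close> is
    nonzero.\<close>
  have "card W \<noteq> 0" using finite_U[OF k] xk card by (simp add: W_def)
  then obtain b where b: "b \<in> W" by fastforce
  define a :: "(nat \<Rightarrow> 'u) \<Rightarrow> (nat \<Rightarrow> 'u) \<Rightarrow> 'f" where "a = place k (\<lambda>u v. shell k 1 u * shell k 1 v)"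
  have aT: "a \<in> T" unfolding a_def by (rule place_block_in_T[OF k]) auto
  have upd: "y(k := w) \<in> X" if "y \<in> X" "w \<in> W" for y w
    using that k W(3) by (auto simp: fact_points_def PiE_iff extensional_def)
  \<comment> \<open>A nonzero row of \<open>a\<close> is the indicator of the points obtained by
    varying the coordinate \<open>k\<close> within \<open>W\<close>, so multiplication by
    \<open>a\<close> becomes a sum over \<open>W\<close>.\<close>
  have a_eq: "a y z = of_bool (y \<in> X \<and> y k \<in> W \<and> z \<in> (\<lambda>w. y(k := w)) ` W)" for y z
  proof -
    have "a y z = of_bool (y \<in> X \<and> z \<in> X \<and> y k \<noteq> x k \<and> z k \<noteq> x k \<and> (\<forall>h\<in>{1..n}. h \<noteq> k \<longrightarrow> y h = z h))"
    proof -
      have "(\<Prod>h\<in>{1..n}. ((\<lambda>h u v. of_bool (u = v))(k := \<lambda>u v. shell k 1 u * shell k 1 v)) h (y h) (z h))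
          = (\<Prod>h\<in>{1..n}. of_bool (if h = k then y k \<noteq> x k \<and> z k \<noteq> x k else y h = z h) :: 'f)"
        by (rule prod.cong) (auto simp: shell_def)
      then show ?thesis using k by (auto simp: a_def place_def tensor_def prod_of_bool)
    qed
    also have "(y \<in> X \<and> z \<in> X \<and> y k \<noteq> x k \<and> z k \<noteq> x k \<and> (\<forall>h\<in>{1..n}. h \<noteq> k \<longrightarrow> y h = z h))
        \<longleftrightarrow> y \<in> X \<and> y k \<in> W \<and> z \<in> (\<lambda>w. y(k := w)) ` W" (is "?L \<longleftrightarrow> ?R")
    proof
      assume L: ?L
      then have "z = y(k := z k)"
        using k by (intro fact_points_eqI[of z n U]) (auto simp: fact_points_def PiE_iff extensional_def)
      moreover have "y k \<in> W" "z k \<in> W" using L X_coord[OF _ k] by (auto simp: W_def)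
      ultimately show ?R using L by blast
    next
      assume ?R
      then show ?L using upd by (auto simp: W_def)
    qed
    finally show ?thesis .
  qed
  have inj: "inj_on (\<lambda>w. y(k := w)) W" for y :: "nat \<Rightarrow> 'u"
    by (rule inj_onI) (metis fun_upd_same)
  have left: "(\<Sum>w\<in>X. a y w * f w) = of_bool (y \<in> X \<and> y k \<in> W) * (\<Sum>w\<in>W. f (y(k := w)))" for y f
  proof (cases "y \<in> X \<and> y k \<in> W")
    case True
    have "(\<Sum>w\<in>X. a y w * f w) = (\<Sum>w\<in>(\<lambda>w. y(k := w)) ` W. f w)"
      by (rule sum.mono_neutral_cong_right[OF finite_X]) (use True upd in \<open>auto simp: a_eq\<close>)
    also have "\<dots> = (\<Sum>w\<in>W. f (y(k := w)))" by (simp add: sum.reindex[OF inj])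
    finally show ?thesis using True by simp
  qed (auto simp: a_eq)
  have sym: "a y z = a z y" for y z
  proof -
    have "z \<in> X \<and> z k \<in> W \<and> y \<in> (\<lambda>w. z(k := w)) ` W"
      if yz: "y \<in> X \<and> y k \<in> W \<and> z \<in> (\<lambda>w. y(k := w)) ` W" for y z :: "nat \<Rightarrow> 'u"
    proof -
      obtain w where w: "w \<in> W" "z = y(k := w)" using yz by blast
      then have "y = z(k := y k)" by auto
      then have "y \<in> (\<lambda>w. z(k := w)) ` W" using yz by blast
      then show ?thesis using yz w upd by simp
    qed
    then show ?thesis unfolding a_eq by (intro arg_cong[where f = of_bool]) blast
  qed
  have right: "(\<Sum>w\<in>X. f w * a w z) = of_bool (z \<in> X \<and> z k \<in> W) * (\<Sum>w\<in>W. f (z(k := w)))" for z f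
    using left[of z f] by (simp add: sym[of _ z] mult.commute)
  have mult: "M \<otimes>\<^bsub>?T\<^esub> N = (\<lambda>y z. \<Sum>w\<in>X. M y w * N w z)" for M N
    by (simp add: terwilliger_algebra_def generated_subalgebra_def mat_algebra_simps)
  have zero: "\<zero>\<^bsub>?T\<^esub> = (\<lambda>y z. 0)" by (simp add: terwilliger_algebra_def generated_subalgebra_def mat_algebra_simps)
  have "a \<otimes>\<^bsub>?T\<^esub> t \<otimes>\<^bsub>?T\<^esub> a = \<zero>\<^bsub>?T\<^esub>" if t: "t \<in> carrier ?T" for t
    unfolding mult zero left right
  proof (intro ext)
    fix y z :: "nat \<Rightarrow> 'u"
    show "of_bool (z \<in> X \<and> z k \<in> W) * (\<Sum>w\<in>W. of_bool (y \<in> X \<and> y k \<in> W) * (\<Sum>w'\<in>W. t (y(k := w')) (z(k := w)))) = 0"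
    proof (cases "y \<in> X \<and> z \<in> X")
      case True
      \<comment> \<open>The inner sum does not depend on \<open>w\<close>, so the double sum is a multiple of \<open>card W\<close>.\<close>
      have const: "(\<Sum>w'\<in>W. t (y(k := w')) (z(k := w))) = (\<Sum>w'\<in>W. t (y(k := w')) (z(k := b)))"
        if w: "w \<in> W" for w
      \<comment> \<open>The transposition of \<open>w\<close> and \<open>b\<close> permutes
        \<open>W\<close>, and applied to both arguments of \<open>t\<close> it moves the column
        coordinate from \<open>w\<close> to \<open>b\<close>.\<close>
      proof (rule sum.reindex_bij_witness[of _ "\<lambda>u. if u = w then b else if u = b then w else u"
            "\<lambda>u. if u = w then b else if u = b then w else u"])
        fix w' assume w': "w' \<in> W"
        have "t (swap w b (y(k := w'))) (swap w b (z(k := w))) = t (y(k := w')) (z(k := w))"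
          using w w' b True W(3) by (intro T_swap_invariant t upd) (auto simp: W_def)
        then show "t (y(k := if w' = w then b else if w' = b then w else w')) (z(k := b)) = t (y(k := w')) (z(k := w))"
          by (simp only: swap_def fun_upd_same fun_upd_upd simp_thms if_True)
      qed (use w b in auto)
      have "(\<Sum>w\<in>W. of_bool (y \<in> X \<and> y k \<in> W) * (\<Sum>w'\<in>W. t (y(k := w')) (z(k := w))))
          = (\<Sum>w\<in>W. of_bool (y \<in> X \<and> y k \<in> W) * (\<Sum>w'\<in>W. t (y(k := w')) (z(k := b))))"
        by (rule sum.cong) (simp_all only: const)
      also have "\<dots> = 0" using W(2) by simp
      finally show ?thesis by simp
    qed auto
  qed
  then have "a = \<zero>\<^bsub>?T\<^esub>" using semisimple_imp_semiprime[OF ss aT] by blast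
  moreover have "a (x(k := b)) (x(k := b)) = 1"
    using b upd[OF base_point b] by (auto simp: a_eq)
  ultimately show False by (simp add: zero)
qed

end

end

section \<open>Reduction of the valency condition to the single factors\<close>

theorem theorem5p20:
  fixes n :: nat and U :: "nat \<Rightarrow> 'u set" and x :: "nat \<Rightarrow> 'u"
  assumes "n \<ge> 1"
    and "\<And>h. h \<in> {1..n} \<Longrightarrow> finite (U h)"
    and "\<And>h. h \<in> {1..n} \<Longrightarrow> card (U h) \<ge> 2"
    and "x \<in> fact_points n U"
  shows "semisimple (terwilliger_algebra n U x ::
           ('f::field, (nat \<Rightarrow> 'u) \<Rightarrow> (nat \<Rightarrow> 'u) \<Rightarrow> 'f) module)
         \<longleftrightarrow> p'_valenced TYPE('f) n U"
proof -
  interpret factorial_scheme n U x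
    by unfold_locales (use assms(2,4) in auto)
  have fin: "finite (index_support n g)" for g by (simp add: index_support_def)
  \<comment> \<open>Valencies of the scheme are products of local ones, and a product in a field is
    nonzero iff all its factors are.\<close>
  have "p'_valenced TYPE('f) n U \<longleftrightarrow> (\<forall>k\<in>{1..n}. (val k :: 'f) \<noteq> 0)"
  proof
    assume pv: "p'_valenced TYPE('f) n U"
    show "\<forall>k\<in>{1..n}. (val k :: 'f) \<noteq> 0"
    proof
      fix k assume k: "k \<in> {1..n}"
      \<comment> \<open>With support \<open>{k}\<close> the valency is the local one of the factor
        \<open>k\<close>.\<close>
      define g where "g = (\<lambda>h\<in>{1..n}. if h = k then 1 else 0 :: nat)"
      have "g \<in> fact_index n" by (auto simp: g_def fact_index_def)
      moreover have "index_support n g = {k}" using k by (auto simp: g_def index_support_def)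
      ultimately show "(val k :: 'f) \<noteq> 0"
        using pv by (auto simp: p'_valenced_def fact_valency_def val_def)
    qed
  next
    assume "\<forall>k\<in>{1..n}. (val k :: 'f) \<noteq> 0"
    then show "p'_valenced TYPE('f) n U"
      unfolding p'_valenced_def fact_valency_def of_nat_prod prod_zero_iff[OF fin]
      by (auto simp: val_def index_support_def)
  qed
  then show ?thesis
    using semisimple_if_valencies_nonzero not_semisimple_if_valency_zero assms(3) by metis
qed

end
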